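(* Let $(Z^{i,j},d^{i,j})$, $0\le i\le n$, $0\le j\le N$, be Hilbert complexes as in the context and let $S^{i,j}:Z^{i,j}\to Z^{i+1,j-1}$ be bounded linear operators with closed range such that for all $i,j$ $$S^{i+1,j}d^{i,j}=-d^{i+1,j-1}S^{i,j},\qquad S^{i+1,j-1}\circ S^{i,j}=0 .$$ Then the BGG sequence $$\cdots\to\Upsilon^{i-1}\xrightarrow{D^{i-1}}\Upsilon^i\xrightarrow{D^i}\Upsilon^{i+1}\to\cdots$$ is a complex, whose cohomology is isomorphic to the cohomology of the twisted complex $(Z^\bullet,d_V^\bullet)$. The maps $A^i:\Upsilon^i\to Z^i$ and $B^i:Z^i\to\Upsilon^i$ are complex maps (i.e. $d_V^iA^i=A^{i+1}D^i$ and $B^{i+1}d_V^i=D^iB^i$) that induce inverse isomorphisms in cohomology. (Thus, if in addition there are bounded linear operators $K^{i,j}:Z^{i,j}\to Z^{i,j-1}$ with $S^{i,j-1}K^{i,j}=K^{i+1,j-1}S^{i,j}$ and $S^{i,j}=d^{i,j-1}K^{i,j}-K^{i+1,j}d^{i,j}$ for all $i,j$, then the cohomology of the BGG complex at each index $k$ is isomorphic to $\bigoplus_{j=0}^N\mathcal{H}^k(Z^{\bullet,j},d^{\bullet,j})$.)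
   Context: $Z^{i,j}$ ($0\le i\le n$, $0\le j\le N$) are Hilbert spaces and $d^{i,j}:Z^{i,j}\to Z^{i+1,j}$ are bounded linear operators with $d^{i+1,j}\circ d^{i,j}=0$. Spaces with indices outside the stated range, and operators from or into them, are zero. Set $Z^i:=\bigoplus_{j=0}^NZ^{i,j}$ (orthogonal direct sum), $d^i:Z^i\to Z^{i+1}$, $(d^i\phi)_j=d^{i,j}\phi_j$, and $S^i:Z^i\to Z^{i+1}$, $(S^i\phi)_j=S^{i,j+1}\phi_{j+1}$ (with $\phi_{N+1}=0$). The twisted operator is $d_V^i:=d^i-S^i$; the assumptions on $S$ give $d_V^{i+1}d_V^i=0$, and $(Z^\bullet,d_V^\bullet)$ is the twisted complex. Write $\mathcal N$ for kernel and $\mathcal R$ for range. Put $\Upsilon^i:=\mathcal R(S^{i-1})^\perp\cap\mathcal N(S^i)\subset Z^i$ (with $\mathcal R(S^{-1})^\perp=Z^0$ and $\mathcal N(S^n)=Z^n$). One has the orthogonal decomposition $Z^i=\mathcal R(S^{i-1})\oplus\mathcal N(S^i)^\perp\oplus\Upsilon^i$; $P_X$ denotes orthogonal projection onto a closed subspace $X$. Let $T^i:Z^i\to Z^{i-1}$ be $T^i:=(S^{i-1})^{-1}\circ P_{\mathcal R(S^{i-1})}$, where $(S^{i-1})^{-1}:\mathcal R(S^{i-1})\to\mathcal N(S^{i-1})^\perp$ is the inverse of the isomorphism $\mathcal N(S^{i-1})^\perp\to\mathcal R(S^{i-1})$ induced by $S^{i-1}$. The operator $T^id^{i-1}$ is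 nilpotent on $Z^{i-1}$, and one defines $$G^i:=-\sum_{k=0}^\infty(T^id^{i-1})^kT^i:Z^i\to Z^{i-1}\quad\text{(a finite sum)},$$ $$A^i:=I-G^{i+1}d_V^i:\Upsilon^i\to Z^i,\qquad D^i:=P_{\Upsilon^{i+1}}d_V^iA^i:\Upsilon^i\to\Upsilon^{i+1},\qquad B^i:=P_{\Upsilon^i}(I-d_V^{i-1}G^i):Z^i\to\Upsilon^i .$$ $\mathcal{H}^k(X^\bullet,d^\bullet)=\mathcal N(d^k)/\mathcal R(d^{k-1})$ denotes the cohomology of a complex at index $k$. *)

theory Defs
  imports "HOL-Analysis.Analysis"
begin

section \<open>Hilbert complexes\<close>

text \<open>
  A Hilbert space is a complete linear subspace of a real inner product space, so that a family of
  Hilbert spaces may be indexed by integers. An operator between two such subspaces is a total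
  function of which only the values on the source are relevant.
\<close>

definition hilbert_subspace :: "'a::real_inner set \<Rightarrow> bool" where
  "hilbert_subspace X \<longleftrightarrow> subspace X \<and> complete X"

definition bounded_operator ::
  "'a::real_normed_vector set \<Rightarrow> 'b::real_normed_vector set \<Rightarrow> ('a \<Rightarrow> 'b) \<Rightarrow> bool" where
  "bounded_operator X Y f \<longleftrightarrow>
     f \<in> X \<rightarrow> Y \<and>
     (\<forall>x\<in>X. \<forall>y\<in>X. f (x + y) = f x + f y) \<and>
     (\<forall>c. \<forall>x\<in>X. f (c *\<^sub>R x) = c *\<^sub>R f x) \<and>
     (\<exists>C. \<forall>x\<in>X. norm (f x) \<le> C * norm x)"

definition hilbert_complex :: "(int \<Rightarrow> 'a::real_inner set) \<Rightarrow> (int \<Rightarrow> 'a \<Rightarrow> 'a) \<Rightarrow> bool" where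
  "hilbert_complex X d \<longleftrightarrow>
     (\<forall>i. hilbert_subspace (X i)) \<and>
     (\<forall>i. bounded_operator (X i) (X (i + 1)) (d i)) \<and>
     (\<forall>i. \<forall>x\<in>X i. d (i + 1) (d i x) = 0)"

definition complex_map ::
  "(int \<Rightarrow> 'a::real_inner set) \<Rightarrow> (int \<Rightarrow> 'a \<Rightarrow> 'a) \<Rightarrow>
   (int \<Rightarrow> 'b::real_inner set) \<Rightarrow> (int \<Rightarrow> 'b \<Rightarrow> 'b) \<Rightarrow> (int \<Rightarrow> 'a \<Rightarrow> 'b) \<Rightarrow> bool" where
  "complex_map X d Y e f \<longleftrightarrow>
     (\<forall>i. bounded_operator (X i) (Y i) (f i)) \<and>
     (\<forall>i. \<forall>x\<in>X i. e i (f i x) = f (i + 1) (d i x))"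

definition kernel_on :: "'a set \<Rightarrow> ('a \<Rightarrow> 'b::zero) \<Rightarrow> 'a set" where
  "kernel_on X f = {x \<in> X. f x = 0}"

definition orth_proj :: "'a::real_inner set \<Rightarrow> 'a \<Rightarrow> 'a" where
  "orth_proj X x = (THE y. y \<in> X \<and> x - y \<in> X\<^sup>\<bottom>)"


section \<open>Cohomology\<close>

text \<open>
  Cohomology spaces are quotients whose elements are cosets; their linear structure is therefore
  recorded explicitly.
\<close>

record 'v vspace =
  vs_carrier :: "'v set"
  vs_add :: "'v \<Rightarrow> 'v \<Rightarrow> 'v"
  vs_scale :: "real \<Rightarrow> 'v \<Rightarrow> 'v"

definition vs_iso_map :: "'v vspace \<Rightarrow> 'w vspace \<Rightarrow> ('v \<Rightarrow> 'w) \<Rightarrow> bool" where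
  "vs_iso_map V W h \<longleftrightarrow>
     bij_betw h (vs_carrier V) (vs_carrier W) \<and>
     (\<forall>x\<in>vs_carrier V. \<forall>y\<in>vs_carrier V. h (vs_add V x y) = vs_add W (h x) (h y)) \<and>
     (\<forall>c. \<forall>x\<in>vs_carrier V. h (vs_scale V c x) = vs_scale W c (h x))"

definition vs_isomorphic :: "'v vspace \<Rightarrow> 'w vspace \<Rightarrow> bool" where
  "vs_isomorphic V W \<longleftrightarrow> (\<exists>h. vs_iso_map V W h)"

text \<open>Only used for finite index sets, where the direct sum is the full product.\<close>

definition vs_direct_sum :: "'i set \<Rightarrow> ('i \<Rightarrow> 'v vspace) \<Rightarrow> ('i \<Rightarrow> 'v) vspace" where
  "vs_direct_sum I V =
     \<lparr> vs_carrier = (\<Pi>\<^sub>E i\<in>I. vs_carrier (V i)),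
       vs_add = (\<lambda>f g. \<lambda>i\<in>I. vs_add (V i) (f i) (g i)),
       vs_scale = (\<lambda>c f. \<lambda>i\<in>I. vs_scale (V i) c (f i)) \<rparr>"

text \<open>
  Cosets are added by elementwise sum. In the scalar multiple the summand \<open>R\<close> only matters for the
  scalar 0; see \<open>quotient_scale_coset\<close>.
\<close>

definition quotient_space :: "'a::real_vector set \<Rightarrow> 'a set \<Rightarrow> 'a set vspace" where
  "quotient_space X R =
     \<lparr> vs_carrier = (\<lambda>x. x +o R) ` X,
       vs_add = (\<lambda>C C'. C + C'),
       vs_scale = (\<lambda>c C. (*\<^sub>R) c ` C + R) \<rparr>"

definition cohomology ::
  "(int \<Rightarrow> 'a::real_vector set) \<Rightarrow> (int \<Rightarrow> 'a \<Rightarrow> 'a) \<Rightarrow> int \<Rightarrow> 'a set vspace" where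
  "cohomology X d k = quotient_space (kernel_on (X k) (d k)) (d (k - 1) ` X (k - 1))"

text \<open>
  The map induced by \<open>f\<close> on cohomology at index \<open>k\<close>, with values in the cohomology of the complex
  \<open>(Y, e)\<close>; see \<open>induced_map_coset\<close>.
\<close>

definition induced_map ::
  "(int \<Rightarrow> 'b::real_vector set) \<Rightarrow> (int \<Rightarrow> 'b \<Rightarrow> 'b) \<Rightarrow> (int \<Rightarrow> 'a \<Rightarrow> 'b) \<Rightarrow>
   int \<Rightarrow> 'a set \<Rightarrow> 'b set" where
  "induced_map Y e f k C = f k ` C + e (k - 1) ` Y (k - 1)"

lemma subspace_set_plus_self:
  fixes R :: "'a::real_vector set"
  assumes "subspace R"
  shows "R + R = R"
proof -
  have "x \<in> R + R" if "x \<in> R" for x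
    using set_plus_intro[OF that subspace_0[OF assms]] by simp
  then show ?thesis
    using subspace_add[OF assms] by (auto elim!: set_plus_elim)
qed

lemma quotient_add_coset:
  fixes R :: "'a::real_vector set"
  assumes "subspace R"
  shows "vs_add (quotient_space X R) (x +o R) (y +o R) = (x + y) +o R"
  using subspace_set_plus_self[OF assms]
  by (simp add: quotient_space_def set_plus_rearrange)

lemma induced_map_coset:
  fixes R :: "'a::real_vector set"
  assumes "subspace (e (k - 1) ` Y (k - 1))" and "0 \<in> R"
    and "f k ` R \<subseteq> e (k - 1) ` Y (k - 1)"
    and "\<And>r. r \<in> R \<Longrightarrow> f k (x + r) = f k x + f k r"
  shows "induced_map Y e f k (x +o R) = f k x +o e (k - 1) ` Y (k - 1)"
proof -
  define Q where "Q = e (k - 1) ` Y (k - 1)"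
  have Q: "subspace Q" "f k ` R \<subseteq> Q"
    using assms by (simp_all add: Q_def)
  have "f k ` (x +o R) = f k x +o f k ` R"
    using assms(4) by (force simp: elt_set_plus_def)
  moreover have "f k ` R + Q = Q"
  proof
    show "f k ` R + Q \<subseteq> Q"
      using Q by (auto elim!: set_plus_elim intro: subspace_add)
    show "Q \<subseteq> f k ` R + Q"
    proof
      fix q assume "q \<in> Q"
      then have "q - f k 0 \<in> Q"
        using Q assms(2) by (auto intro: subspace_diff)
      then have "f k 0 + (q - f k 0) \<in> f k ` R + Q"
        using assms(2) by (intro set_plus_intro) auto
      then show "q \<in> f k ` R + Q" by simp
    qed
  qed
  ultimately show ?thesis
    by (simp add: induced_map_def set_plus_rearrange3 flip: Q_def)
qed

lemma quotient_scale_coset: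
  fixes R :: "'a::real_vector set"
  assumes "subspace R"
  shows "vs_scale (quotient_space X R) c (x +o R) = (c *\<^sub>R x) +o R"
proof -
  have "induced_map (\<lambda>_. R) (\<lambda>_ x. x) (\<lambda>_. (*\<^sub>R) c) 0 (x +o R) =
      (c *\<^sub>R x) +o (\<lambda>x. x) ` R"
    by (rule induced_map_coset)
       (use assms in \<open>auto simp: subspace_0 subspace_scale scaleR_add_right\<close>)
  then show ?thesis
    by (simp add: quotient_space_def induced_map_def)
qed


section \<open>Orthogonal direct sums\<close>

text \<open>
  Finitely supported families, with the inner product of the orthogonal direct sum. (The analogous
  type of the library's polynomial mappings carries the sum norm, which is not an inner product
  norm.)
\<close>

typedef (overloaded) ('i, 'a) dsum = "{f :: 'i \<Rightarrow> 'a::real_vector. finite {i. f i \<noteq> 0}}"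
  morphisms component Dsum
  by (rule exI[of _ "\<lambda>_. 0"]) simp

lemma finite_component: "finite {i. component x i \<noteq> 0}"
  using component[of x] by simp

lemma component_Dsum: "finite {i. f i \<noteq> 0} \<Longrightarrow> component (Dsum f) = f"
  by (simp add: Dsum_inverse)

lemma dsum_eqI: "(\<And>i. component x i = component y i) \<Longrightarrow> x = y"
  by (metis component_inject ext)

instantiation dsum :: (type, real_vector) real_vector
begin

definition zero_dsum :: "('a, 'b) dsum" where
  "0 = Dsum (\<lambda>_. 0)"
definition plus_dsum :: "('a, 'b) dsum \<Rightarrow> ('a, 'b) dsum \<Rightarrow> ('a, 'b) dsum" where
  "x + y = Dsum (\<lambda>i. component x i + component y i)"
definition uminus_dsum :: "('a, 'b) dsum \<Rightarrow> ('a, 'b) dsum" where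
  "- x = Dsum (\<lambda>i. - component x i)"
definition minus_dsum :: "('a, 'b) dsum \<Rightarrow> ('a, 'b) dsum \<Rightarrow> ('a, 'b) dsum" where
  "x - y = Dsum (\<lambda>i. component x i - component y i)"
definition scaleR_dsum :: "real \<Rightarrow> ('a, 'b) dsum \<Rightarrow> ('a, 'b) dsum" where
  "c *\<^sub>R x = Dsum (\<lambda>i. c *\<^sub>R component x i)"

lemma component_zero [simp]: "component 0 i = 0"
  by (simp add: zero_dsum_def component_Dsum)

lemma component_add [simp]: "component (x + y) i = component x i + component y i"
proof -
  have "finite {i. component x i + component y i \<noteq> 0}"
    by (rule finite_subset[OF _ finite_UnI[OF finite_component[of x] finite_component[of y]]]) auto
  then show ?thesis by (simp add: plus_dsum_def component_Dsum)
qed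

lemma component_uminus [simp]: "component (- x) i = - component x i"
  by (simp add: uminus_dsum_def component_Dsum finite_component)

lemma component_diff [simp]: "component (x - y) i = component x i - component y i"
proof -
  have "finite {i. component x i - component y i \<noteq> 0}"
    by (rule finite_subset[OF _ finite_UnI[OF finite_component[of x] finite_component[of y]]]) auto
  then show ?thesis by (simp add: minus_dsum_def component_Dsum)
qed

lemma component_scaleR [simp]: "component (c *\<^sub>R x) i = c *\<^sub>R component x i"
proof -
  have "finite {i. c *\<^sub>R component x i \<noteq> 0}"
    by (rule finite_subset[OF _ finite_component[of x]]) auto
  then show ?thesis by (simp add: scaleR_dsum_def component_Dsum)
qed

instance
  by standard (auto intro!: dsum_eqI simp: algebra_simps)

end

instantiation dsum :: (type, real_inner) real_inner
begin

definition inner_dsum_def: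
  "inner (x :: ('a, 'b) dsum) y = (\<Sum>i | component x i \<noteq> 0. inner (component x i) (component y i))"
definition norm_dsum_def:
  "norm (x :: ('a, 'b) dsum) = sqrt (inner x x)"
definition sgn_dsum_def:
  "sgn (x :: ('a, 'b) dsum) = inverse (norm x) *\<^sub>R x"
definition dist_dsum_def:
  "dist (x :: ('a, 'b) dsum) y = norm (x - y)"
definition uniformity_dsum_def:
  "(uniformity :: (('a, 'b) dsum \<times> ('a, 'b) dsum) filter) =
     (INF e\<in>{0 <..}. principal {(x, y). dist x y < e})"
definition open_dsum_def:
  "open (U :: ('a, 'b) dsum set) \<longleftrightarrow>
     (\<forall>x\<in>U. eventually (\<lambda>(x', y). x' = x \<longrightarrow> y \<in> U) uniformity)"

lemma inner_dsum_superset: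
  assumes "finite I" "{i. component x i \<noteq> 0} \<subseteq> I"
  shows "inner x y = (\<Sum>i\<in>I. inner (component x i) (component y i))"
  unfolding inner_dsum_def by (rule sum.mono_neutral_left) (use assms in auto)

instance
proof
  fix x y z :: "('a, 'b) dsum" and r :: real
  define I where
    "I = {i. component x i \<noteq> 0} \<union> {i. component y i \<noteq> 0} \<union> {i. component z i \<noteq> 0}"
  have fin: "finite I"
    by (simp add: I_def finite_component)
  have sub: "{i. component x i \<noteq> 0} \<subseteq> I" "{i. component y i \<noteq> 0} \<subseteq> I"
    "{i. component (x + y) i \<noteq> 0} \<subseteq> I" "{i. component (r *\<^sub>R x) i \<noteq> 0} \<subseteq> I"
    by (auto simp: I_def)
  note I = sub[THEN inner_dsum_superset[OF fin]]
  show "inner x y = inner y x"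
    by (simp add: I inner_commute)
  show "inner (x + y) z = inner x z + inner y z"
    by (simp add: I inner_add_left sum.distrib)
  show "inner (r *\<^sub>R x) y = r * inner x y"
    by (simp add: I sum_distrib_left)
  show "0 \<le> inner x x"
    by (simp add: I sum_nonneg)
  show "inner x x = 0 \<longleftrightarrow> x = 0"
  proof
    assume "inner x x = 0"
    then have "\<forall>i\<in>I. component x i = 0"
      using fin by (simp add: I sum_nonneg_eq_0_iff)
    then show "x = 0"
      using sub(1) by (auto intro!: dsum_eqI)
  qed (simp add: inner_dsum_def)
  show "norm x = sqrt (inner x x)"
    by (rule norm_dsum_def)
  show "sgn x = x /\<^sub>R norm x"
    by (rule sgn_dsum_def)
  show "dist x y = norm (x - y)"
    by (rule dist_dsum_def)
  show "(uniformity :: (('a, 'b) dsum \<times> _) filter) =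
      (INF e\<in>{0 <..}. principal {(x, y). dist x y < e})"
    by (rule uniformity_dsum_def)
  show "open U \<longleftrightarrow> (\<forall>x\<in>U. \<forall>\<^sub>F (x', y) in uniformity. x' = x \<longrightarrow> y \<in> U)"
    for U :: "('a, 'b) dsum set"
    by (rule open_dsum_def)
qed

end


section \<open>The twisted complex and the BGG sequence\<close>

text \<open>
  In these definitions \<open>Z i j\<close>, \<open>d i j\<close> and \<open>S i j\<close> are indexed by all pairs of integers. If
  \<open>Z i j = {0}\<close> outside a finite range of \<open>j\<close>, then \<open>total_space Z i\<close> is the orthogonal direct sum
  of the \<open>Z i j\<close> within that range.
\<close>

definition total_space :: "(int \<Rightarrow> int \<Rightarrow> 'a::real_vector set) \<Rightarrow> int \<Rightarrow> (int, 'a) dsum set" where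
  "total_space Z i = {\<phi>. \<forall>j. component \<phi> j \<in> Z i j}"

definition total_d ::
  "(int \<Rightarrow> int \<Rightarrow> 'a::real_vector \<Rightarrow> 'a) \<Rightarrow> int \<Rightarrow> (int, 'a) dsum \<Rightarrow> (int, 'a) dsum" where
  "total_d d i \<phi> = Dsum (\<lambda>j. d i j (component \<phi> j))"

definition total_S ::
  "(int \<Rightarrow> int \<Rightarrow> 'a::real_vector \<Rightarrow> 'a) \<Rightarrow> int \<Rightarrow> (int, 'a) dsum \<Rightarrow> (int, 'a) dsum" where
  "total_S S i \<phi> = Dsum (\<lambda>j. S i (j + 1) (component \<phi> (j + 1)))"

text \<open>
  From here on \<open>Z\<close>, \<open>d\<close> and \<open>S\<close> denote the total spaces and the total operators.
\<close>

definition twisted_d :: "(int \<Rightarrow> 'v \<Rightarrow> 'v) \<Rightarrow> (int \<Rightarrow> 'v \<Rightarrow> 'v) \<Rightarrow> int \<Rightarrow> 'v::real_inner \<Rightarrow> 'v" where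
  "twisted_d d S i x = d i x - S i x"

definition bgg_space :: "(int \<Rightarrow> 'v::real_inner set) \<Rightarrow> (int \<Rightarrow> 'v \<Rightarrow> 'v) \<Rightarrow> int \<Rightarrow> 'v set" where
  "bgg_space Z S i = (S (i - 1) ` Z (i - 1))\<^sup>\<bottom> \<inter> kernel_on (Z i) (S i)"

definition bgg_T :: "(int \<Rightarrow> 'v::real_inner set) \<Rightarrow> (int \<Rightarrow> 'v \<Rightarrow> 'v) \<Rightarrow> int \<Rightarrow> 'v \<Rightarrow> 'v" where
  "bgg_T Z S i y =
     the_inv_into (Z (i - 1) \<inter> (kernel_on (Z (i - 1)) (S (i - 1)))\<^sup>\<bottom>) (S (i - 1))
       (orth_proj (S (i - 1) ` Z (i - 1)) y)"

definition bgg_G ::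
  "(int \<Rightarrow> 'v::real_inner set) \<Rightarrow> (int \<Rightarrow> 'v \<Rightarrow> 'v) \<Rightarrow> (int \<Rightarrow> 'v \<Rightarrow> 'v) \<Rightarrow> int \<Rightarrow> 'v \<Rightarrow> 'v" where
  "bgg_G Z d S i y = - (\<Sum>k. ((bgg_T Z S i \<circ> d (i - 1)) ^^ k) (bgg_T Z S i y))"

definition bgg_A ::
  "(int \<Rightarrow> 'v::real_inner set) \<Rightarrow> (int \<Rightarrow> 'v \<Rightarrow> 'v) \<Rightarrow> (int \<Rightarrow> 'v \<Rightarrow> 'v) \<Rightarrow> int \<Rightarrow> 'v \<Rightarrow> 'v" where
  "bgg_A Z d S i x = x - bgg_G Z d S (i + 1) (twisted_d d S i x)"

definition bgg_D ::
  "(int \<Rightarrow> 'v::real_inner set) \<Rightarrow> (int \<Rightarrow> 'v \<Rightarrow> 'v) \<Rightarrow> (int \<Rightarrow> 'v \<Rightarrow> 'v) \<Rightarrow> int \<Rightarrow> 'v \<Rightarrow> 'v" where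
  "bgg_D Z d S i x = orth_proj (bgg_space Z S (i + 1)) (twisted_d d S i (bgg_A Z d S i x))"

definition bgg_B ::
  "(int \<Rightarrow> 'v::real_inner set) \<Rightarrow> (int \<Rightarrow> 'v \<Rightarrow> 'v) \<Rightarrow> (int \<Rightarrow> 'v \<Rightarrow> 'v) \<Rightarrow> int \<Rightarrow> 'v \<Rightarrow> 'v" where
  "bgg_B Z d S i x = orth_proj (bgg_space Z S i) (x - twisted_d d S (i - 1) (bgg_G Z d S i x))"

end

theory Submission
  imports Defs
begin

text \<open>
  Write \<open>V = d - S\<close> for the twisted differential. The operator \<open>G\<close> is a contracting homotopy built
  from the partial inverse \<open>T\<close> of \<open>S\<close>: since \<open>T S\<close> is the identity on \<open>(ker S)\<^sup>\<bottom>\<close> and \<open>T T = 0\<close>,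
  the geometric series \<open>G = - (T + T d T + T d T d T + ...)\<close> satisfies \<open>G G = 0\<close>, \<open>G V G = G\<close> and
  \<open>G V T = T\<close>. The first two identities make \<open>Q = 1 - G V - V G\<close> an idempotent map of the twisted
  complex that is homotopic to the identity. The third shows, together with \<open>G T = 0\<close>, that
  \<open>Q\<close> vanishes on \<open>(ker S)\<^sup>\<bottom>\<close>, the range of \<open>T\<close>. Thus an element of the range of \<open>Q\<close>, which \<open>G\<close> annihilates and which
  is therefore orthogonal to the range of \<open>S\<close>, is recovered by \<open>Q\<close> from its orthogonal projection \<open>P\<close>
  to \<open>\<Upsilon>\<close>.

  On \<open>\<Upsilon>\<close> the operator \<open>A\<close> is \<open>Q\<close>, and \<open>B = P Q\<close>. Hence \<open>B A = 1\<close>, \<open>A B = Q\<close> and \<open>D = B V A\<close>, and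
  everything claimed about the BGG sequence is formal: for instance \<open>A D = Q V A = V Q A = V A\<close> and
  \<open>D D = B V Q V A = B V V A = 0\<close>. The complex \<open>(\<Upsilon>, D)\<close> is the range of \<open>Q\<close>, transported to \<open>\<Upsilon>\<close> by the
  mutually inverse maps \<open>P\<close> and \<open>Q\<close>. The lemmas that carry this are \<open>G_dV_G\<close>, \<open>Q_Ker_complement\<close>,
  \<open>A_B\<close> and \<open>B_A\<close>.

  Two facts of functional analysis enter. The orthogonal projection onto a complete subspace exists
  (\<open>orthogonal_projection_exists\<close>), and a bounded bijection between complete spaces has a bounded
  inverse (\<open>bounded_operator_the_inv_into\<close>); the latter makes \<open>T\<close>, and with it \<open>G\<close>, \<open>A\<close>, \<open>B\<close> and
  \<open>D\<close>, bounded. The series for \<open>G\<close> is finite because \<open>S\<close> lowers the second degree by one, so \<open>T\<close>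
  raises it by one, while \<open>d\<close> preserves it (\<open>bgg_twist_total\<close>).

  If \<open>S\<close> is the commutator \<open>d K - K d\<close> and commutes with \<open>K\<close>, then \<open>(d - S) exp K = exp K d\<close>, where
  the exponential series is finite. So \<open>exp K\<close> is an isomorphism from the untwisted to the
  twisted complex (\<open>twisted_cohomology_isomorphic\<close>), and the cohomology of the untwisted complex is
  the direct sum of the cohomologies of its rows (\<open>cohomology_total\<close>).
\<close>

section \<open>Bounded operators between subspaces\<close>

lemma bounded_operator_cong:
  assumes "bounded_operator X Y f" and "\<And>x. x \<in> X \<Longrightarrow> g x = f x" and "subspace X"
  shows "bounded_operator X Y g"
  using assms subspace_add[OF assms(3)] subspace_scale[OF assms(3)]
  unfolding bounded_operator_def by (auto simp: Pi_iff)

lemma bounded_operatorD: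
  assumes "bounded_operator X Y f"
  shows bounded_operator_mem: "x \<in> X \<Longrightarrow> f x \<in> Y"
    and bounded_operator_add: "\<lbrakk>x \<in> X; y \<in> X\<rbrakk> \<Longrightarrow> f (x + y) = f x + f y"
    and bounded_operator_scaleR: "x \<in> X \<Longrightarrow> f (c *\<^sub>R x) = c *\<^sub>R f x"
  using assms by (auto simp: bounded_operator_def)

lemma bounded_operator_pos_bound:
  assumes "bounded_operator X Y f"
  obtains C where "C > 0" "\<And>x. x \<in> X \<Longrightarrow> norm (f x) \<le> C * norm x"
proof -
  obtain C where C: "\<And>x. x \<in> X \<Longrightarrow> norm (f x) \<le> C * norm x"
    using assms unfolding bounded_operator_def by blast
  have "norm (f x) \<le> max C 1 * norm x" if "x \<in> X" for x
    using C[OF that] mult_right_mono[of C "max C 1" "norm x"] by simp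
  then show thesis
    using that[of "max C 1"] by simp
qed

lemma bounded_operator_zero:
  assumes "bounded_operator X Y f" "subspace X"
  shows "f 0 = 0"
  using bounded_operator_scaleR[OF assms(1) subspace_0[OF assms(2)], of 0] by simp

lemma bounded_operator_uminus:
  assumes "bounded_operator X Y f" "x \<in> X"
  shows "f (- x) = - f x"
  using bounded_operator_scaleR[OF assms, of "-1"] by simp

lemma bounded_operator_diff:
  assumes "bounded_operator X Y f" "subspace X" "x \<in> X" "y \<in> X"
  shows "f (x - y) = f x - f y"
  using bounded_operator_add[OF assms(1) assms(3), of "- y"]
    bounded_operator_uminus[OF assms(1) assms(4)] assms by (simp add: subspace_neg)

lemma bounded_operator_sum:
  assumes "bounded_operator X Y f" "subspace X" "\<And>k. k \<in> K \<Longrightarrow> g k \<in> X"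
  shows "f (\<Sum>k\<in>K. g k) = (\<Sum>k\<in>K. f (g k))"
  using assms(3)
proof (induction K rule: infinite_finite_induct)
  case (insert k K)
  then show ?case
    using bounded_operator_add[OF assms(1), of "g k" "sum g K"] subspace_sum[OF assms(2), of K g]
    by simp
qed (simp_all add: bounded_operator_zero[OF assms(1,2)])

lemma bounded_operator_subset:
  assumes "bounded_operator X Y f" "X' \<subseteq> X" "\<And>x. x \<in> X' \<Longrightarrow> f x \<in> Y'"
  shows "bounded_operator X' Y' f"
proof -
  obtain C where "\<And>x. x \<in> X \<Longrightarrow> norm (f x) \<le> C * norm x"
    using assms(1) unfolding bounded_operator_def by blast
  then have "\<forall>x\<in>X'. norm (f x) \<le> C * norm x"
    using assms(2) by blast
  then show ?thesis
    using assms unfolding bounded_operator_def by (blast intro: Pi_I)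
qed

lemma bounded_operator_id: "bounded_operator X X (\<lambda>x. x)"
  unfolding bounded_operator_def by (auto intro!: exI[of _ 1])

lemma bounded_operator_compose:
  assumes f: "bounded_operator X Y f" and g: "bounded_operator Y W g"
  shows "bounded_operator X W (\<lambda>x. g (f x))"
proof -
  obtain C where C: "C > 0" "\<And>x. x \<in> X \<Longrightarrow> norm (f x) \<le> C * norm x"
    using bounded_operator_pos_bound[OF f] by blast
  obtain D where D: "D > 0" "\<And>x. x \<in> Y \<Longrightarrow> norm (g x) \<le> D * norm x"
    using bounded_operator_pos_bound[OF g] by blast
  have "norm (g (f x)) \<le> (D * C) * norm x" if "x \<in> X" for x
    using order_trans[OF D(2)[OF bounded_operator_mem[OF f that]] mult_left_mono[OF C(2)[OF that]]]
      D(1) by (simp add: mult.assoc)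
  then show ?thesis
    using assms by (auto simp: bounded_operator_def Pi_iff)
qed

lemma bounded_operator_add_fun:
  assumes f: "bounded_operator X Y f" and g: "bounded_operator X Y g" and Y: "subspace Y"
  shows "bounded_operator X Y (\<lambda>x. f x + g x)"
proof -
  obtain C where C: "C > 0" "\<And>x. x \<in> X \<Longrightarrow> norm (f x) \<le> C * norm x"
    using bounded_operator_pos_bound[OF f] by blast
  obtain D where D: "D > 0" "\<And>x. x \<in> X \<Longrightarrow> norm (g x) \<le> D * norm x"
    using bounded_operator_pos_bound[OF g] by blast
  have "norm (f x + g x) \<le> (C + D) * norm x" if "x \<in> X" for x
    using norm_triangle_mono[OF C(2) D(2), OF that that] by (simp add: distrib_right)
  then show ?thesis
    using f g subspace_add[OF Y] unfolding bounded_operator_def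
    by (auto simp: Pi_iff scaleR_add_right)
qed

lemma bounded_operator_scaleR_fun:
  assumes f: "bounded_operator X Y f" and Y: "subspace Y"
  shows "bounded_operator X Y (\<lambda>x. c *\<^sub>R f x)"
proof (rule bounded_operator_compose[OF f])
  show "bounded_operator Y Y ((*\<^sub>R) c)"
    unfolding bounded_operator_def
    by (auto simp: scaleR_add_right subspace_scale[OF Y] intro!: exI[of _ "\<bar>c\<bar>"])
qed

lemma bounded_operator_uminus_fun:
  assumes "bounded_operator X Y f" "subspace Y"
  shows "bounded_operator X Y (\<lambda>x. - f x)"
  using bounded_operator_scaleR_fun[OF assms, of "-1"] by simp

lemma bounded_operator_diff_fun:
  assumes "bounded_operator X Y f" "bounded_operator X Y g" "subspace Y"
  shows "bounded_operator X Y (\<lambda>x. f x - g x)"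
  using bounded_operator_add_fun[OF assms(1) bounded_operator_uminus_fun[OF assms(2,3)] assms(3)]
  by simp

lemma bounded_operator_sum_fun:
  assumes "\<And>k. k \<in> K \<Longrightarrow> bounded_operator X Y (f k)" "subspace Y"
  shows "bounded_operator X Y (\<lambda>x. \<Sum>k\<in>K. f k x)"
  using assms(1)
proof (induction K rule: infinite_finite_induct)
  case (insert k K)
  then show ?case
    using bounded_operator_add_fun[of X Y "f k" "\<lambda>x. \<Sum>k\<in>K. f k x"] assms(2) by simp
qed (use subspace_0[OF assms(2)] in \<open>auto simp: bounded_operator_def intro!: exI[of _ 0]\<close>)

lemma bounded_operator_funpow:
  assumes "bounded_operator X X f"
  shows "bounded_operator X X (f ^^ k)"
proof (induction k)
  case 0
  show ?case using bounded_operator_id[of X] by (simp add: id_def)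
next
  case (Suc k)
  show ?case
    using bounded_operator_compose[OF Suc assms] by (simp add: o_def)
qed

lemma subspace_image_bounded_operator:
  assumes f: "bounded_operator X Y f" and X: "subspace X"
  shows "subspace (f ` X)"
proof (rule subspaceI)
  show "0 \<in> f ` X"
    using bounded_operator_zero[OF f X] subspace_0[OF X] by (metis imageI)
  show "x + y \<in> f ` X" if "x \<in> f ` X" "y \<in> f ` X" for x y
    using that bounded_operator_add[OF f] subspace_add[OF X] by (auto simp: image_iff) metis
  show "c *\<^sub>R x \<in> f ` X" if "x \<in> f ` X" for x c
    using that bounded_operator_scaleR[OF f] subspace_scale[OF X] by (auto simp: image_iff) metis
qed

lemma subspace_kernel_on:
  assumes f: "bounded_operator X Y f" and X: "subspace X"
  shows "subspace (kernel_on X f)"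
  using bounded_operator_zero[OF f X] bounded_operator_add[OF f] bounded_operator_scaleR[OF f] X
  unfolding kernel_on_def subspace_def by auto

lemma continuous_on_bounded_operator:
  assumes f: "bounded_operator X Y f" and X: "subspace X"
  shows "continuous_on X f"
proof -
  obtain C where C: "C > 0" "\<And>x. x \<in> X \<Longrightarrow> norm (f x) \<le> C * norm x"
    using bounded_operator_pos_bound[OF f] by blast
  have "C-lipschitz_on X f"
    using C(2)[OF subspace_diff[OF X]] C(1) bounded_operator_diff[OF f X]
    by (auto intro!: lipschitz_onI simp: dist_norm)
  then show ?thesis
    by (rule lipschitz_on_continuous_on)
qed

lemma complete_kernel_on:
  fixes X :: "'a::real_inner set"
  assumes f: "bounded_operator X Y f" and X: "subspace X" "complete X"
  shows "complete (kernel_on X f)"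
proof -
  have "closedin (top_of_set X) (X \<inter> f -` {0})"
    by (rule continuous_closedin_preimage[OF continuous_on_bounded_operator[OF f X(1)]]) simp
  then have "closed (X \<inter> f -` {0})"
    using X(2) by (meson closedin_closed_trans complete_imp_closed)
  moreover have "X \<inter> f -` {0} = X \<inter> kernel_on X f" "kernel_on X f = X \<inter> f -` {0}"
    by (auto simp: kernel_on_def)
  ultimately show ?thesis
    using complete_Int_closed[OF X(2), of "kernel_on X f"] by metis
qed

section \<open>Orthogonal projections\<close>

lemma closed_orthogonal_comp:
  fixes W :: "'a::real_inner set"
  shows "closed (W\<^sup>\<bottom>)"
proof -
  have "W\<^sup>\<bottom> = (\<Inter>y\<in>W. {x. y \<bullet> x = 0})"
    by (auto simp: orthogonal_comp_def orthogonal_def)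
  then show ?thesis
    by (auto intro!: closed_INT closed_Collect_eq continuous_intros)
qed

lemma orthogonal_compD:
  assumes "x \<in> W\<^sup>\<bottom>" "w \<in> W"
  shows "w \<bullet> x = 0" "x \<bullet> w = 0"
  using assms by (auto simp: orthogonal_comp_def orthogonal_def inner_commute)

lemma orthogonal_comp_disjoint:
  fixes x :: "'a::real_inner"
  assumes "x \<in> W" "x \<in> W\<^sup>\<bottom>"
  shows "x = 0"
  using orthogonal_compD(1)[OF assms(2,1)] by simp

text \<open>
  A sequence in \<open>X\<close> whose distances to \<open>x\<close> tend to the infimum is Cauchy by the parallelogram law.
  Its limit is a nearest point, and comparing it with its neighbours on a line shows that the
  residual is orthogonal to \<open>X\<close>.
\<close>

lemma orthogonal_projection_exists:
  fixes X :: "'a::real_inner set"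
  assumes X: "subspace X" "complete X"
  shows "\<exists>y\<in>X. x - y \<in> X\<^sup>\<bottom>"
proof -
  define D where "D = (INF y\<in>X. (norm (x - y))\<^sup>2)"
  have bdd: "bdd_below ((\<lambda>y. (norm (x - y))\<^sup>2) ` X)"
    by (rule bdd_belowI[of _ 0]) auto
  have D_le: "D \<le> (norm (x - y))\<^sup>2" if "y \<in> X" for y
    unfolding D_def by (rule cINF_lower[OF bdd that])
  have "\<exists>y\<in>X. (norm (x - y))\<^sup>2 < D + inverse (Suc n)" for n
    using cINF_less_iff[OF _ bdd, of "D + inverse (Suc n)"] subspace_0[OF X(1)]
    unfolding D_def by force
  then obtain y where y: "\<And>n. y n \<in> X" "\<And>n. (norm (x - y n))\<^sup>2 < D + inverse (Suc n)"
    by metis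
  \<comment> \<open>the parallelogram law, with the midpoint of \<open>y m\<close> and \<open>y n\<close> as competitor\<close>
  have close: "(norm (y m - y n))\<^sup>2 \<le> 4 * inverse (Suc M)" if "M \<le> m" "M \<le> n" for M m n
  proof -
    have "(1/2) *\<^sub>R (y m + y n) \<in> X"
      using y(1) X(1) by (simp add: subspace_add subspace_scale)
    note D_le[OF this]
    moreover have "4 * (norm (x - (1/2) *\<^sub>R (y m + y n)))\<^sup>2 + (norm (y m - y n))\<^sup>2 =
        2 * (norm (x - y m))\<^sup>2 + 2 * (norm (x - y n))\<^sup>2"
      by (simp add: power2_norm_eq_inner inner_diff_left inner_diff_right inner_add_left
          inner_add_right inner_commute field_simps)
    moreover have "inverse (real (Suc m)) \<le> inverse (real (Suc M))"
      "inverse (real (Suc n)) \<le> inverse (real (Suc M))"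
      using that by auto
    ultimately show ?thesis
      using y(2)[of m] y(2)[of n] by linarith
  qed
  have "Cauchy y"
  proof (rule metric_CauchyI)
    fix e :: real assume e: "0 < e"
    obtain M where M: "inverse (real (Suc M)) < e\<^sup>2 / 4"
      using reals_Archimedean[of "e\<^sup>2 / 4"] e by auto
    have "dist (y m) (y n) < e" if "M \<le> m" "M \<le> n" for m n
    proof (rule power2_less_imp_less)
      show "(dist (y m) (y n))\<^sup>2 < e\<^sup>2"
        using close[OF that] M by (simp add: dist_norm)
    qed (use e in simp)
    then show "\<exists>M. \<forall>m\<ge>M. \<forall>n\<ge>M. dist (y m) (y n) < e" by blast
  qed
  then obtain p where p: "p \<in> X" "y \<longlonglongrightarrow> p"
    using X(2) y(1) unfolding complete_def by blast
  have "(norm (x - p))\<^sup>2 \<le> D + 0"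
  proof (rule LIMSEQ_le)
    show "(\<lambda>n. (norm (x - y n))\<^sup>2) \<longlonglongrightarrow> (norm (x - p))\<^sup>2"
      using p(2) by (intro tendsto_intros)
    show "(\<lambda>n. D + inverse (real (Suc n))) \<longlonglongrightarrow> D + 0"
      by (intro tendsto_intros LIMSEQ_inverse_real_of_nat)
    show "\<exists>N. \<forall>n\<ge>N. (norm (x - y n))\<^sup>2 \<le> D + inverse (real (Suc n))"
      using y(2) less_imp_le by blast
  qed
  then have min: "(norm (x - p))\<^sup>2 \<le> (norm (x - z))\<^sup>2" if "z \<in> X" for z
    using D_le[OF that] by linarith
  have "w \<bullet> (x - p) = 0" if w: "w \<in> X" for w
  proof (cases "w = 0")
    case False
    \<comment> \<open>\<open>t w\<close> is the projection of the residual to the line through \<open>w\<close>, the best competitor on it\<close>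
    define t where "t = (w \<bullet> (x - p)) / (w \<bullet> w)"
    have "p + t *\<^sub>R w \<in> X"
      using p(1) w X(1) by (simp add: subspace_add subspace_scale)
    from min[OF this] have "(norm (x - p))\<^sup>2 \<le> (norm ((x - p) - t *\<^sub>R w))\<^sup>2"
      by (simp add: algebra_simps)
    also have "\<dots> = (norm (x - p))\<^sup>2 - (w \<bullet> (x - p))\<^sup>2 / (w \<bullet> w)"
    proof -
      have "(norm (u - t *\<^sub>R w))\<^sup>2 = (norm u)\<^sup>2 - (2 * t * (w \<bullet> u) - t\<^sup>2 * (w \<bullet> w))" for u
        unfolding power2_norm_eq_inner
        by (simp add: inner_diff_left inner_diff_right inner_commute power2_eq_square algebra_simps)
      moreover have "2 * t * (w \<bullet> (x - p)) - t\<^sup>2 * (w \<bullet> w) = (w \<bullet> (x - p))\<^sup>2 / (w \<bullet> w)"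
        using False by (simp add: t_def power2_eq_square)
      ultimately show ?thesis by presburger
    qed
    finally have "(w \<bullet> (x - p))\<^sup>2 / (w \<bullet> w) \<le> 0" by simp
    then show ?thesis
      using False by (simp add: divide_le_0_iff) (metis inner_ge_zero inner_eq_zero_iff order_antisym)
  qed simp
  then show ?thesis
    using p(1) by (auto simp: orthogonal_comp_def orthogonal_def)
qed

lemma orth_proj_unique:
  fixes X :: "'a::real_inner set"
  assumes "subspace X" "y \<in> X" "x - y \<in> X\<^sup>\<bottom>"
  shows "orth_proj X x = y"
  unfolding orth_proj_def
proof (rule the_equality)
  fix z assume z: "z \<in> X \<and> x - z \<in> X\<^sup>\<bottom>"
  then have "z - y \<in> X" "(x - y) - (x - z) \<in> X\<^sup>\<bottom>"
    using assms subspace_diff[OF subspace_orthogonal_comp, of "x - y" X "x - z"]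
    by (auto simp: subspace_diff)
  then show "z = y"
    using orthogonal_comp_disjoint[of "z - y" X] by simp
qed (use assms in simp)

lemma orth_proj:
  fixes X :: "'a::real_inner set"
  assumes "subspace X" "complete X"
  shows orth_proj_mem: "orth_proj X x \<in> X"
    and orth_proj_diff: "x - orth_proj X x \<in> X\<^sup>\<bottom>"
  using orthogonal_projection_exists[OF assms, of x] orth_proj_unique[OF assms(1)] by metis+

lemma bounded_operator_orth_proj:
  fixes X :: "'a::real_inner set"
  assumes X: "subspace X" "complete X"
  shows "bounded_operator UNIV X (orth_proj X)"
proof -
  note P = orth_proj[OF X]
  have "norm (orth_proj X x) \<le> norm x" for x
  proof -
    have "orth_proj X x \<bullet> (x - orth_proj X x) = 0"
      by (rule orthogonal_compD[OF P(2) P(1)])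
    then have "(norm x)\<^sup>2 = (norm (orth_proj X x))\<^sup>2 + (norm (x - orth_proj X x))\<^sup>2"
      by (simp add: power2_norm_eq_inner inner_diff_left inner_diff_right inner_commute)
    then have "(norm (orth_proj X x))\<^sup>2 \<le> (norm x)\<^sup>2" by simp
    then show ?thesis by (rule power2_le_imp_le) simp
  qed
  moreover have "orth_proj X (x + y) = orth_proj X x + orth_proj X y" for x y
  proof (rule orth_proj_unique[OF X(1)])
    show "x + y - (orth_proj X x + orth_proj X y) \<in> X\<^sup>\<bottom>"
      using subspace_add[OF subspace_orthogonal_comp P(2) P(2), of x y]
      by (simp add: algebra_simps)
  qed (use P(1) X(1) in \<open>simp add: subspace_add\<close>)
  moreover have "orth_proj X (c *\<^sub>R x) = c *\<^sub>R orth_proj X x" for c x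
  proof (rule orth_proj_unique[OF X(1)])
    show "c *\<^sub>R x - c *\<^sub>R orth_proj X x \<in> X\<^sup>\<bottom>"
      using subspace_scale[OF subspace_orthogonal_comp P(2), of c] by (simp add: scaleR_diff_right)
  qed (use P(1) X(1) in \<open>simp add: subspace_scale\<close>)
  ultimately show ?thesis
    using P(1) unfolding bounded_operator_def by (auto intro!: exI[of _ 1])
qed

section \<open>The bounded inverse theorem\<close>

text \<open>
  The images of the balls of integer radius cover \<open>R\<close>, so by Baire's theorem the closure of one of
  them contains a ball around some \<open>y0\<close>. A small \<open>y\<close> is the difference of \<open>y0 + y\<close> and \<open>y0\<close>, both
  of which are approximated by images of bounded vectors; scaling gives the bound for all \<open>y\<close>.
\<close>

lemma nearly_open_image:
  fixes M :: "'a::real_inner set" and R :: "'b::real_inner set"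
  assumes f: "bounded_operator M R f" and M: "subspace M" and R: "subspace R" "complete R"
    and surj: "f ` M = R"
  obtains C where "C > 0"
    "\<And>y \<delta>. \<lbrakk>y \<in> R; \<delta> > 0\<rbrakk> \<Longrightarrow> \<exists>x\<in>M. norm x \<le> C * norm y \<and> norm (y - f x) \<le> \<delta>"
proof -
  interpret R: Metric_space R dist
    by unfold_locales (auto simp: dist_commute dist_triangle)
  have lim: "limitin R.mtopology \<sigma> l sequentially \<longleftrightarrow>
      l \<in> R \<and> (\<forall>\<^sub>F n in sequentially. \<sigma> n \<in> R) \<and> \<sigma> \<longlonglongrightarrow> l" for \<sigma> l
    unfolding R.limitin_metric tendsto_iff eventually_conj_iff using zero_less_one by blast
  have mcomplete: "R.mcomplete"
    unfolding R.mcomplete_def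
  proof (intro allI impI)
    fix \<sigma> assume "R.MCauchy \<sigma>"
    then have "range \<sigma> \<subseteq> R" "Cauchy \<sigma>"
      unfolding R.MCauchy_def Cauchy_def by auto
    then show "\<exists>x. limitin R.mtopology \<sigma> x sequentially"
      using R(2) unfolding complete_def lim by (auto simp: image_subset_iff)
  qed
  \<comment> \<open>closed sets that cover \<open>R\<close>; one of them has interior points\<close>
  define F where "F n = R \<inter> closure (f ` (M \<inter> cball 0 (real n)))" for n :: nat
  have closed_F: "closedin R.mtopology (F n)" for n
    unfolding R.metric_closedin_iff_sequentially_closed
  proof (intro conjI allI impI)
    show "F n \<subseteq> R" by (auto simp: F_def)
    fix \<sigma> l assume "range \<sigma> \<subseteq> F n \<and> limitin R.mtopology \<sigma> l sequentially"
    then show "l \<in> F n"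
      using closed_sequentially[of "closure (f ` (M \<inter> cball 0 (real n)))" \<sigma> l]
      by (auto simp: lim F_def)
  qed
  have "R \<subseteq> \<Union> (range F)"
  proof
    fix y assume "y \<in> R"
    then obtain x where x: "x \<in> M" "y = f x"
      using surj by blast
    obtain n where "norm x \<le> real n"
      using real_arch_simple by blast
    then have "y \<in> F n"
      using x \<open>y \<in> R\<close> closure_subset[of "f ` (M \<inter> cball 0 (real n))"] by (auto simp: F_def)
    then show "y \<in> \<Union> (range F)" by blast
  qed
  then have "\<Union> (range F) = R"
    by (auto simp: F_def)
  then have "R.mtopology interior_of \<Union> (range F) = R"
    using interior_of_topspace[of R.mtopology] by simp
  then have "R.mtopology interior_of \<Union> (range F) \<noteq> {}"
    using subspace_0[OF R(1)] by auto
  then obtain n where "R.mtopology interior_of F n \<noteq> {}"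
    using R.metric_Baire_category_alt[OF mcomplete, of "range F"] closed_F by auto
  then obtain y0 e where y0: "y0 \<in> R" "e > 0" "R.mball y0 e \<subseteq> F n"
    by (auto simp: R.in_interior_of_mball)
  have approx: "\<exists>x\<in>M. norm x \<le> real n \<and> norm (y0 + y - f x) < \<delta>"
    if "y \<in> R" "norm y < e" "\<delta> > 0" for y \<delta>
  proof -
    have "y0 + y \<in> F n"
      using y0 that(1,2) R(1) by (auto simp: subset_iff subspace_add dist_norm)
    then obtain x where "x \<in> M" "norm x \<le> real n" "dist (f x) (y0 + y) < \<delta>"
      using \<open>\<delta> > 0\<close> by (auto simp: F_def closure_approachable)
    then show ?thesis
      by (auto simp: dist_norm norm_minus_commute)
  qed
  show thesis
  proof
    show "4 * (real n + 1) / e > 0"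
      using y0 by (simp add: divide_pos_pos)
    fix y \<delta> assume y: "y \<in> R" and \<delta>: "(\<delta>::real) > 0"
    show "\<exists>x\<in>M. norm x \<le> 4 * (real n + 1) / e * norm y \<and> norm (y - f x) \<le> \<delta>"
    proof (cases "y = 0")
      case True
      then show ?thesis
        using \<delta> subspace_0[OF M] bounded_operator_zero[OF f M] by (auto intro!: bexI[of _ 0])
    next
      case False
      \<comment> \<open>rescales \<open>y\<close> to norm \<open>e / 2\<close>, inside the ball given by Baire's theorem\<close>
      define s where "s = e / (2 * norm y)"
      have s: "s > 0" "norm (s *\<^sub>R y) < e"
        using y0(2) False by (auto simp: s_def)
      have sR: "s *\<^sub>R y \<in> R" "0 \<in> R"
        using y R(1) by (auto simp: subspace_scale subspace_0)
      obtain x1 where x1: "x1 \<in> M" "norm x1 \<le> real n" "norm (y0 + s *\<^sub>R y - f x1) < s * \<delta> / 2"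
        using approx[OF sR(1) s(2), of "s * \<delta> / 2"] s \<delta> by auto
      obtain x2 where x2: "x2 \<in> M" "norm x2 \<le> real n" "norm (y0 + 0 - f x2) < s * \<delta> / 2"
        using approx[OF sR(2), of "s * \<delta> / 2"] s \<delta> y0 by auto
      define x where "x = inverse s *\<^sub>R (x1 - x2)"
      have x: "x \<in> M" "f x = inverse s *\<^sub>R (f x1 - f x2)"
        using x1 x2 M bounded_operator_scaleR[OF f] bounded_operator_diff[OF f M]
        by (auto simp: x_def subspace_scale subspace_diff)
      have "norm x = inverse s * norm (x1 - x2)"
        using s by (simp add: x_def)
      also have "\<dots> \<le> inverse s * (2 * (real n + 1))"
        using s x1 x2 norm_triangle_ineq4[of x1 x2] by (intro mult_left_mono) auto
      also have "\<dots> = 4 * (real n + 1) / e * norm y"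
        using y0 by (simp add: s_def field_simps)
      finally have bound: "norm x \<le> \<dots>" .
      have "y - f x = inverse s *\<^sub>R ((y0 + s *\<^sub>R y - f x1) - (y0 + 0 - f x2))"
        using s by (simp add: x algebra_simps)
      then have "norm (y - f x) = inverse s * norm ((y0 + s *\<^sub>R y - f x1) - (y0 + 0 - f x2))"
        using s by simp
      also have "\<dots> \<le> inverse s * (s * \<delta> / 2 + s * \<delta> / 2)"
        using s x1 x2 norm_triangle_ineq4[of "y0 + s *\<^sub>R y - f x1" "y0 + 0 - f x2"]
        by (intro mult_left_mono) (linarith, simp)
      also have "\<dots> = \<delta>"
        using s by simp
      finally show ?thesis
        using bound x by blast
    qed
  qed
qed

text \<open>
  Approximate preimages of the successive residuals, each at most half as large as the one before,
  are summed to an exact preimage.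
\<close>

lemma bounded_preimage:
  fixes M :: "'a::real_inner set" and R :: "'b::real_inner set"
  assumes f: "bounded_operator M R f" and M: "subspace M" "complete M"
    and R: "subspace R" "complete R" and surj: "f ` M = R"
  obtains C where "\<And>y. y \<in> R \<Longrightarrow> \<exists>x\<in>M. f x = y \<and> norm x \<le> C * norm y"
proof -
  obtain C where C: "C > 0"
    "\<And>y \<delta>. \<lbrakk>y \<in> R; \<delta> > 0\<rbrakk> \<Longrightarrow> \<exists>x\<in>M. norm x \<le> C * norm y \<and> norm (y - f x) \<le> \<delta>"
    using nearly_open_image[OF f M(1) R surj] by blast
  have "\<exists>x\<in>M. f x = y \<and> norm x \<le> (2 * C) * norm y" if y: "y \<in> R" "y \<noteq> 0" for y
  proof -
    define b where "b k = norm y / 2 ^ k" for k :: nat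
    have b: "b k > 0" "b (Suc k) = b k / 2" for k
      using y by (simp_all add: b_def)
    have b_lim: "b \<longlonglongrightarrow> 0"
      using tendsto_mult_right_zero[OF LIMSEQ_inverse_realpow_zero[of 2], of "norm y"]
      by (simp add: b_def[abs_def] divide_inverse)
    \<comment> \<open>partial sums \<open>X k\<close> whose residual \<open>y - f (X k)\<close> halves at each step\<close>
    have "\<exists>X. \<forall>k. (X k \<in> M \<and> norm (y - f (X k)) \<le> b k \<and> (k = 0 \<longrightarrow> X k = 0)) \<and>
        norm (X (Suc k) - X k) \<le> C * b k"
    proof (rule dependent_nat_choice)
      show "\<exists>x. x \<in> M \<and> norm (y - f x) \<le> b 0 \<and> (0 = 0 \<longrightarrow> x = 0)"
        using subspace_0[OF M(1)] bounded_operator_zero[OF f M(1)] by (auto simp: b_def)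
      fix x and k :: nat
      assume x: "x \<in> M \<and> norm (y - f x) \<le> b k \<and> (k = 0 \<longrightarrow> x = 0)"
      then have "y - f x \<in> R"
        using y R(1) bounded_operator_mem[OF f] by (auto simp: subspace_diff)
      then obtain u where u: "u \<in> M" "norm u \<le> C * norm (y - f x)"
          "norm (y - f x - f u) \<le> b (Suc k)"
        using C(2)[OF _ b(1)] by blast
      have "norm u \<le> C * b k"
        using u(2) x C(1) by (meson mult_left_mono less_imp_le order_trans)
      then show "\<exists>z. (z \<in> M \<and> norm (y - f z) \<le> b (Suc k) \<and> (Suc k = 0 \<longrightarrow> z = 0)) \<and>
          norm (z - x) \<le> C * b k"
        using x u M(1) bounded_operator_add[OF f, of x u]
        by (intro exI[of _ "x + u"]) (auto simp: subspace_add algebra_simps)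
    qed
    then obtain X where X: "\<And>k. X k \<in> M" "\<And>k. norm (y - f (X k)) \<le> b k" "X 0 = 0"
      "\<And>k. norm (X (Suc k) - X k) \<le> C * b k"
      by blast
    have step: "norm (X (m + k) - X m) \<le> 2 * C * (b m - b (m + k))" for m k
    proof (induction k)
      case (Suc k)
      have "norm (X (m + Suc k) - X m) \<le> norm (X (Suc (m + k)) - X (m + k)) + norm (X (m + k) - X m)"
        using norm_triangle_ineq[of "X (Suc (m + k)) - X (m + k)" "X (m + k) - X m"] by simp
      also have "\<dots> \<le> C * b (m + k) + 2 * C * (b m - b (m + k))"
        using Suc X(4) by (intro add_mono) auto
      also have "\<dots> = 2 * C * (b m - b (m + Suc k))"
        by (simp add: b(2) algebra_simps)
      finally show ?case .
    qed simp
    have step': "norm (X n - X m) \<le> 2 * C * b m" if "m \<le> n" for m n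
    proof -
      have "norm (X n - X m) \<le> 2 * C * (b m - b n)"
        using step[of m "n - m"] that by simp
      also have "\<dots> \<le> 2 * C * b m"
        using C(1) b(1)[of n] by (intro mult_left_mono) auto
      finally show ?thesis .
    qed
    have "Cauchy X"
    proof (rule CauchyI')
      fix e :: real assume "0 < e"
      have "(\<lambda>m. 2 * C * b m) \<longlonglongrightarrow> 0"
        using tendsto_mult_right_zero[OF b_lim, of "2 * C"] by simp
      then obtain m0 where "\<And>m. m \<ge> m0 \<Longrightarrow> norm (2 * C * b m) < e"
        using LIMSEQ_D[OF _ \<open>0 < e\<close>] by fastforce
      then have "dist (X m) (X n) < e" if "m0 \<le> m" "m < n" for m n
        using step'[of m n] that by (force simp: dist_norm norm_minus_commute)
      then show "\<exists>M. \<forall>m\<ge>M. \<forall>n>m. dist (X m) (X n) < e" by blast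
    qed
    then obtain x where x: "x \<in> M" "X \<longlonglongrightarrow> x"
      using M(2) X(1) unfolding complete_def by blast
    have "(\<lambda>k. f (X k)) \<longlonglongrightarrow> f x"
      using continuous_on_bounded_operator[OF f M(1)] x X(1)
      by (auto simp: continuous_on_sequentially o_def)
    moreover have "(\<lambda>k. f (X k)) \<longlonglongrightarrow> y"
      by (rule LIM_zero_cancel, rule Lim_null_comparison[OF _ b_lim]) (use X(2) in \<open>simp add: norm_minus_commute\<close>)
    ultimately have "f x = y"
      by (rule LIMSEQ_unique)
    moreover have "norm x \<le> 2 * C * norm y"
    proof (rule LIMSEQ_le_const2[OF tendsto_norm[OF x(2)]])
      show "\<exists>N. \<forall>n\<ge>N. norm (X n) \<le> 2 * C * norm y"
        using step'[of 0] X(3) by (auto simp: b_def)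
    qed
    ultimately show ?thesis
      using x(1) by blast
  qed
  then have "\<exists>x\<in>M. f x = y \<and> norm x \<le> (2 * C) * norm y" if "y \<in> R" for y
    using that subspace_0[OF M(1)] bounded_operator_zero[OF f M(1)] by (cases "y = 0") auto
  then show thesis
    by (rule that)
qed

lemma bounded_operator_the_inv_into:
  fixes M :: "'a::real_inner set" and R :: "'b::real_inner set"
  assumes f: "bounded_operator M R f" and M: "subspace M" "complete M"
    and R: "subspace R" "complete R" and bij: "bij_betw f M R"
  shows "bounded_operator R M (the_inv_into M f)"
proof -
  have inj: "inj_on f M" and surj: "f ` M = R"
    using bij by (auto simp: bij_betw_def)
  obtain C where C: "\<And>y. y \<in> R \<Longrightarrow> \<exists>x\<in>M. f x = y \<and> norm x \<le> C * norm y"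
    using bounded_preimage[OF f M R surj] by blast
  have inv: "the_inv_into M f y = x" if "x \<in> M" "f x = y" for x y
    using the_inv_into_f_f[OF inj that(1)] that(2) by simp
  have mem: "the_inv_into M f y \<in> M" "f (the_inv_into M f y) = y" if "y \<in> R" for y
    using C[OF that] inv by auto
  show ?thesis
    unfolding bounded_operator_def
  proof (intro conjI ballI allI exI)
    show "the_inv_into M f \<in> R \<rightarrow> M"
      using mem by auto
    show "the_inv_into M f (x + y) = the_inv_into M f x + the_inv_into M f y"
      if "x \<in> R" "y \<in> R" for x y
      using mem[OF that(1)] mem[OF that(2)] M(1)
      by (intro inv) (auto simp: subspace_add bounded_operator_add[OF f])
    show "the_inv_into M f (c *\<^sub>R x) = c *\<^sub>R the_inv_into M f x" if "x \<in> R" for c x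
      using mem[OF that] M(1)
      by (intro inv) (auto simp: subspace_scale bounded_operator_scaleR[OF f])
    show "norm (the_inv_into M f y) \<le> C * norm y" if "y \<in> R" for y
      using C[OF that] inv by auto
  qed
qed

section \<open>Maps induced on cohomology\<close>

lemma hilbert_complexD:
  assumes "hilbert_complex X d"
  shows hilbert_complex_subspace: "subspace (X i)"
    and hilbert_complex_complete: "complete (X i)"
    and hilbert_complex_bounded: "bounded_operator (X i) (X (i + 1)) (d i)"
    and hilbert_complex_square: "x \<in> X i \<Longrightarrow> d (i + 1) (d i x) = 0"
  using assms by (auto simp: hilbert_complex_def hilbert_subspace_def)

lemma hilbert_complex_bounded':
  assumes "hilbert_complex X d"
  shows "bounded_operator (X (i - 1)) (X i) (d (i - 1))"
  using hilbert_complex_bounded[OF assms, of "i - 1"] by simp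

lemma hilbert_complex_square':
  assumes "hilbert_complex X d" "x \<in> X (i - 1)"
  shows "d i (d (i - 1) x) = 0"
  using hilbert_complex_square[OF assms] by simp

lemma complex_mapD:
  assumes "complex_map X d Y e f"
  shows complex_map_bounded: "bounded_operator (X i) (Y i) (f i)"
    and complex_map_commutes: "x \<in> X i \<Longrightarrow> e i (f i x) = f (i + 1) (d i x)"
  using assms by (auto simp: complex_map_def)

lemma subspace_boundaries:
  assumes "hilbert_complex X d"
  shows "subspace (d (k - 1) ` X (k - 1))"
  by (rule subspace_image_bounded_operator[OF hilbert_complex_bounded[OF assms]
        hilbert_complex_subspace[OF assms]])

lemma boundaries_subset_cycles:
  assumes "hilbert_complex X d"
  shows "d (k - 1) ` X (k - 1) \<subseteq> kernel_on (X k) (d k)"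
  using bounded_operator_mem[OF hilbert_complex_bounded'[OF assms]] hilbert_complex_square'[OF assms]
  by (auto simp: kernel_on_def)

lemma subspace_cycles:
  assumes "hilbert_complex X d"
  shows "subspace (kernel_on (X k) (d k))"
  by (rule subspace_kernel_on[OF hilbert_complex_bounded[OF assms] hilbert_complex_subspace[OF assms]])

lemma vs_carrier_cohomology:
  "vs_carrier (cohomology X d k) = (\<lambda>x. x +o d (k - 1) ` X (k - 1)) ` kernel_on (X k) (d k)"
  by (simp add: cohomology_def quotient_space_def)

lemma coset_eq_iff:
  fixes R :: "'a::real_vector set"
  assumes "subspace R"
  shows "x +o R = y +o R \<longleftrightarrow> x - y \<in> R"
proof
  assume "x +o R = y +o R"
  moreover have "x + 0 \<in> x +o R"
    using subspace_0[OF assms] by (rule set_plus_intro2)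
  ultimately show "x - y \<in> R"
    by (auto simp: elt_set_plus_def)
next
  assume *: "x - y \<in> R"
  have "x + r \<in> y +o R" if "r \<in> R" for r
    using subspace_add[OF assms * that] by (auto simp: elt_set_plus_def intro!: bexI[of _ "x - y + r"])
  moreover have "y + r \<in> x +o R" if "r \<in> R" for r
    using subspace_diff[OF assms that *]
    by (auto simp: elt_set_plus_def intro!: bexI[of _ "r - (x - y)"])
  ultimately show "x +o R = y +o R"
    by (auto simp: elt_set_plus_def)
qed

lemma complex_map_cycle:
  assumes X: "hilbert_complex X d" and f: "complex_map X d Y e f" and x: "x \<in> kernel_on (X k) (d k)"
  shows "f k x \<in> kernel_on (Y k) (e k)"
  using x complex_map_commutes[OF f, of x k] bounded_operator_mem[OF complex_map_bounded[OF f]]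
    bounded_operator_zero[OF complex_map_bounded[OF f] hilbert_complex_subspace[OF X]]
  by (auto simp: kernel_on_def)

lemma complex_map_boundary:
  assumes X: "hilbert_complex X d" and f: "complex_map X d Y e f"
  shows "f k ` d (k - 1) ` X (k - 1) \<subseteq> e (k - 1) ` Y (k - 1)"
  using complex_map_commutes[OF f, of _ "k - 1", symmetric]
    bounded_operator_mem[OF complex_map_bounded[OF f]] by auto

lemma induced_map_cocycle_class:
  assumes X: "hilbert_complex X d" and Y: "hilbert_complex Y e" and f: "complex_map X d Y e f"
    and x: "x \<in> kernel_on (X k) (d k)"
  shows "induced_map Y e f k (x +o d (k - 1) ` X (k - 1)) = f k x +o e (k - 1) ` Y (k - 1)"
proof (rule induced_map_coset)
  show "f k (x + r) = f k x + f k r" if "r \<in> d (k - 1) ` X (k - 1)" for r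
    using that x boundaries_subset_cycles[OF X, of k]
    by (intro bounded_operator_add[OF complex_map_bounded[OF f]]) (auto simp: kernel_on_def)
qed (use subspace_boundaries[OF X] subspace_boundaries[OF Y] complex_map_boundary[OF X f]
  in \<open>auto intro: subspace_0\<close>)

lemma induced_map_linear:
  assumes X: "hilbert_complex X d" and Y: "hilbert_complex Y e" and f: "complex_map X d Y e f"
    and C: "C \<in> vs_carrier (cohomology X d k)"
  shows "C' \<in> vs_carrier (cohomology X d k) \<Longrightarrow>
      induced_map Y e f k (vs_add (cohomology X d k) C C') =
      vs_add (cohomology Y e k) (induced_map Y e f k C) (induced_map Y e f k C')" (is "_ \<Longrightarrow> ?add")
    and "induced_map Y e f k (vs_scale (cohomology X d k) c C) =
      vs_scale (cohomology Y e k) c (induced_map Y e f k C)" (is ?scale)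
proof -
  note ind = induced_map_cocycle_class[OF X Y f, of _ k]
  note cyc = subspace_cycles[OF X, of k]
  note lin = bounded_operatorD[OF complex_map_bounded[OF f, of k]]
  obtain x where x: "x \<in> kernel_on (X k) (d k)" "C = x +o d (k - 1) ` X (k - 1)"
    using C by (auto simp: vs_carrier_cohomology)
  have xX: "x \<in> X k"
    using x by (simp add: kernel_on_def)
  show ?scale
    using x xX ind[OF x(1)] ind[OF subspace_scale[OF cyc x(1), of c]] lin(3)
    by (simp add: cohomology_def quotient_scale_coset[OF subspace_boundaries[OF X]]
        quotient_scale_coset[OF subspace_boundaries[OF Y]])
  assume "C' \<in> vs_carrier (cohomology X d k)"
  then obtain x' where x': "x' \<in> kernel_on (X k) (d k)" "C' = x' +o d (k - 1) ` X (k - 1)"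
    by (auto simp: vs_carrier_cohomology)
  have "x' \<in> X k"
    using x' by (simp add: kernel_on_def)
  then show ?add
    using x x' xX ind[OF x(1)] ind[OF x'(1)] ind[OF subspace_add[OF cyc x(1) x'(1)]] lin(2)
    by (simp add: cohomology_def quotient_add_coset[OF subspace_boundaries[OF X]]
        quotient_add_coset[OF subspace_boundaries[OF Y]])
qed

text \<open>
  Only the effect on cycles modulo boundaries matters, so that a map which is homotopic to the identity
  acts as the identity.
\<close>

lemma induced_map_inverse:
  assumes X: "hilbert_complex X d" and Y: "hilbert_complex Y e"
    and f: "complex_map X d Y e f" and g: "complex_map Y e X d g"
    and gf: "\<And>x. x \<in> kernel_on (X k) (d k) \<Longrightarrow> g k (f k x) - x \<in> d (k - 1) ` X (k - 1)"
    and C: "C \<in> vs_carrier (cohomology X d k)"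
  shows "induced_map X d g k (induced_map Y e f k C) = C"
proof -
  obtain x where x: "x \<in> kernel_on (X k) (d k)" "C = x +o d (k - 1) ` X (k - 1)"
    using C by (auto simp: vs_carrier_cohomology)
  then show ?thesis
    using gf[OF x(1)] coset_eq_iff[OF subspace_boundaries[OF X]]
    by (simp add: induced_map_cocycle_class[OF X Y f] induced_map_cocycle_class[OF Y X g]
        complex_map_cycle[OF X f])
qed

lemma induced_map_iso:
  assumes X: "hilbert_complex X d" and Y: "hilbert_complex Y e"
    and f: "complex_map X d Y e f" and g: "complex_map Y e X d g"
    and gf: "\<And>x. x \<in> kernel_on (X k) (d k) \<Longrightarrow> g k (f k x) - x \<in> d (k - 1) ` X (k - 1)"
    and fg: "\<And>y. y \<in> kernel_on (Y k) (e k) \<Longrightarrow> f k (g k y) - y \<in> e (k - 1) ` Y (k - 1)"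
  shows "vs_iso_map (cohomology X d k) (cohomology Y e k) (induced_map Y e f k)"
  unfolding vs_iso_map_def
proof (intro conjI ballI allI induced_map_linear[OF X Y f])
  have "induced_map Y e f k ` vs_carrier (cohomology X d k) \<subseteq> vs_carrier (cohomology Y e k)"
    if "hilbert_complex X d" "hilbert_complex Y e" "complex_map X d Y e f" for X d Y e f
    using complex_map_cycle[OF that(1,3)]
    by (auto simp: vs_carrier_cohomology induced_map_cocycle_class[OF that])
  from this[OF X Y f] this[OF Y X g]
  show "bij_betw (induced_map Y e f k) (vs_carrier (cohomology X d k)) (vs_carrier (cohomology Y e k))"
    using induced_map_inverse[OF X Y f g gf] induced_map_inverse[OF Y X g f fg]
    by (intro bij_betw_byWitness[of _ "induced_map X d g k"]) auto
qed

lemma vs_isomorphicI: "vs_iso_map V W h \<Longrightarrow> vs_isomorphic V W"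
  by (auto simp: vs_isomorphic_def)

lemma vs_isomorphic_trans:
  assumes "vs_isomorphic U V" "vs_isomorphic V W"
  shows "vs_isomorphic U W"
proof -
  obtain g h where g: "vs_iso_map U V g" and h: "vs_iso_map V W h"
    using assms by (auto simp: vs_isomorphic_def)
  have "g x \<in> vs_carrier V" if "x \<in> vs_carrier U" for x
    using g that by (auto simp: vs_iso_map_def bij_betw_def)
  then have "vs_iso_map U W (h \<circ> g)"
    using g h bij_betw_trans[of g "vs_carrier U" "vs_carrier V" h "vs_carrier W"]
    by (auto simp: vs_iso_map_def)
  then show ?thesis
    by (rule vs_isomorphicI)
qed

section \<open>The twisted complex\<close>

text \<open>
  One complex with an operator \<open>S\<close> of degree 1 that squares to zero and anticommutes with \<open>d\<close>. The
  second grading will enter only through the nilpotency of \<open>T d\<close>.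
\<close>

locale twisted_complex =
  fixes Z :: "int \<Rightarrow> 'v::real_inner set" and d S :: "int \<Rightarrow> 'v \<Rightarrow> 'v"
  assumes complex: "hilbert_complex Z d"
    and S_bounded: "bounded_operator (Z i) (Z (i + 1)) (S i)"
    and S_d: "x \<in> Z i \<Longrightarrow> S (i + 1) (d i x) = - d (i + 1) (S i x)"
    and S_S: "x \<in> Z i \<Longrightarrow> S (i + 1) (S i x) = 0"
begin

abbreviation dV where "dV \<equiv> twisted_d d S"

lemmas subspace_Z = hilbert_complex_subspace[OF complex]
lemmas d_bounded = hilbert_complex_bounded[OF complex]
lemmas d_bounded' = hilbert_complex_bounded'[OF complex]

lemma S_bounded': "bounded_operator (Z (i - 1)) (Z i) (S (i - 1))"
  using S_bounded[of "i - 1"] by simp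

lemma dV_bounded: "bounded_operator (Z i) (Z (i + 1)) (dV i)"
  unfolding twisted_d_def[abs_def] by (rule bounded_operator_diff_fun[OF d_bounded S_bounded subspace_Z])

lemma dV_bounded': "bounded_operator (Z (i - 1)) (Z i) (dV (i - 1))"
  using dV_bounded[of "i - 1"] by simp

lemma hilbert_complex_twisted: "hilbert_complex Z dV"
  unfolding hilbert_complex_def
proof (intro conjI allI ballI)
  show "hilbert_subspace (Z i)" for i
    using complex by (simp add: hilbert_complex_def)
  show "bounded_operator (Z i) (Z (i + 1)) (dV i)" for i
    by (rule dV_bounded)
  show "dV (i + 1) (dV i x) = 0" if "x \<in> Z i" for i x
  proof -
    have mem: "d i x \<in> Z (i + 1)" "S i x \<in> Z (i + 1)"
      using that d_bounded S_bounded by (auto dest: bounded_operator_mem)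
    then show ?thesis
      using that S_d S_S hilbert_complex_square[OF complex]
      by (simp add: twisted_d_def bounded_operator_diff[OF d_bounded subspace_Z mem]
          bounded_operator_diff[OF S_bounded subspace_Z mem])
  qed
qed

end

section \<open>The partial inverse of the twisting operator\<close>

locale closed_range_twist = twisted_complex Z d S
  for Z :: "int \<Rightarrow> 'v::real_inner set" and d S :: "int \<Rightarrow> 'v \<Rightarrow> 'v" +
  assumes complete_range: "complete (S i ` Z i)"
begin

abbreviation T where "T \<equiv> bgg_T Z S"
abbreviation Ran where "Ran i \<equiv> S (i - 1) ` Z (i - 1)"
abbreviation Ker where "Ker i \<equiv> kernel_on (Z i) (S i)"

lemma complete_Z: "complete (Z i)"
  by (rule hilbert_complex_complete[OF complex])

lemma Ran_subspace: "subspace (Ran i)"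
  by (rule subspace_image_bounded_operator[OF S_bounded subspace_Z])

text \<open>
  This is \<open>S S = 0\<close>; it makes \<open>(ker S)\<^sup>\<bottom>\<close> orthogonal to the range of \<open>S\<close>, whence \<open>T T = 0\<close>.
\<close>

lemma Ran_subset_Ker: "Ran i \<subseteq> Ker i"
  using bounded_operator_mem[OF S_bounded'] S_S[of _ "i - 1"] by (auto simp: kernel_on_def)

lemma Ker_complement:
  shows Ker_complement_subspace: "subspace (Z i \<inter> (Ker i)\<^sup>\<bottom>)"
    and Ker_complement_complete: "complete (Z i \<inter> (Ker i)\<^sup>\<bottom>)"
  by (simp_all add: subspace_Z subspace_inter subspace_orthogonal_comp complete_Int_closed complete_Z
      closed_orthogonal_comp)

lemma Ker_subspace: "subspace (Ker i)"
  by (rule subspace_kernel_on[OF S_bounded subspace_Z])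

lemma Ker_complete: "complete (Ker i)"
  by (rule complete_kernel_on[OF S_bounded subspace_Z complete_Z])

lemma bij_S: "bij_betw (S (i - 1)) (Z (i - 1) \<inter> (Ker (i - 1))\<^sup>\<bottom>) (Ran i)"
  unfolding bij_betw_def
proof
  show "inj_on (S (i - 1)) (Z (i - 1) \<inter> (Ker (i - 1))\<^sup>\<bottom>)"
  proof (rule inj_onI)
    fix x y assume *: "x \<in> Z (i - 1) \<inter> (Ker (i - 1))\<^sup>\<bottom>" "y \<in> Z (i - 1) \<inter> (Ker (i - 1))\<^sup>\<bottom>"
      "S (i - 1) x = S (i - 1) y"
    then have "x - y \<in> Z (i - 1) \<inter> (Ker (i - 1))\<^sup>\<bottom>"
      by (intro subspace_diff[OF Ker_complement_subspace])
    moreover have "x - y \<in> Ker (i - 1)"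
      using * subspace_Z by (auto simp: kernel_on_def bounded_operator_diff[OF S_bounded] subspace_diff)
    ultimately show "x = y"
      using orthogonal_comp_disjoint[of "x - y"] by simp
  qed
  have "S (i - 1) x \<in> S (i - 1) ` (Z (i - 1) \<inter> (Ker (i - 1))\<^sup>\<bottom>)" if x: "x \<in> Z (i - 1)" for x
  proof -
    define k where "k = orth_proj (Ker (i - 1)) x"
    have k: "k \<in> Ker (i - 1)" "x - k \<in> (Ker (i - 1))\<^sup>\<bottom>"
      unfolding k_def by (rule orth_proj[OF Ker_subspace Ker_complete])+
    then have "k \<in> Z (i - 1)" "S (i - 1) (x - k) = S (i - 1) x"
      using x bounded_operator_diff[OF S_bounded subspace_Z x, of k] by (auto simp: kernel_on_def)
    then show ?thesis
      using k x subspace_Z by (intro image_eqI[of _ _ "x - k"]) (auto simp: subspace_diff)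
  qed
  then show "S (i - 1) ` (Z (i - 1) \<inter> (Ker (i - 1))\<^sup>\<bottom>) = Ran i"
    by auto
qed

lemma T_bounded:
  "bounded_operator UNIV (Z (i - 1) \<inter> (Ker (i - 1))\<^sup>\<bottom>) (T i)"
  unfolding bgg_T_def[abs_def]
proof (rule bounded_operator_compose[where f = "orth_proj (Ran i)"])
  show "bounded_operator UNIV (Ran i) (orth_proj (Ran i))"
    by (rule bounded_operator_orth_proj[OF Ran_subspace complete_range])
  have "bounded_operator (Z (i - 1) \<inter> (Ker (i - 1))\<^sup>\<bottom>) (Ran i) (S (i - 1))"
    by (rule bounded_operator_subset[OF S_bounded]) auto
  then show "bounded_operator (Ran i) (Z (i - 1) \<inter> (Ker (i - 1))\<^sup>\<bottom>)
      (the_inv_into (Z (i - 1) \<inter> (Ker (i - 1))\<^sup>\<bottom>) (S (i - 1)))"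
    by (rule bounded_operator_the_inv_into[OF _ Ker_complement Ran_subspace complete_range bij_S])
qed

lemma T_mem: "T i y \<in> Z (i - 1)" "T i y \<in> (Ker (i - 1))\<^sup>\<bottom>"
  using bounded_operator_mem[OF T_bounded] by auto

lemma T_mem': "T (i + 1) y \<in> Z i" "T (i + 1) y \<in> (Ker i)\<^sup>\<bottom>"
  using T_mem[of "i + 1"] by simp_all

lemma T_zero: "T i 0 = 0"
  by (rule bounded_operator_zero[OF T_bounded subspace_UNIV])

lemma T_diff: "T i (x - y) = T i x - T i y"
  by (rule bounded_operator_diff[OF T_bounded subspace_UNIV]) auto

lemma T_bounded_Z: "bounded_operator (Z i) (Z (i - 1)) (T i)"
  by (rule bounded_operator_subset[OF T_bounded]) (simp_all add: T_mem)

lemma S_T: "S (i - 1) (T i y) = orth_proj (Ran i) y"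
  unfolding bgg_T_def
  by (rule f_the_inv_into_f_bij_betw[OF bij_S]) (rule orth_proj_mem[OF Ran_subspace complete_range])

lemma T_S:
  assumes "x \<in> Z (i - 1)" "x \<in> (Ker (i - 1))\<^sup>\<bottom>"
  shows "T i (S (i - 1) x) = x"
proof -
  have "orth_proj (Ran i) (S (i - 1) x) = S (i - 1) x"
    using assms subspace_orthogonal_comp[of "Ran i"]
    by (intro orth_proj_unique[OF Ran_subspace]) (auto simp: subspace_0)
  then show ?thesis
    using assms bij_S[of i] by (simp add: bgg_T_def the_inv_into_f_f bij_betw_def)
qed

text \<open>
  \<open>T\<close> is injective on the range of \<open>S\<close>, so its kernel is that of the projection to this range.
\<close>

lemma T_eq_0_iff: "T i y = 0 \<longleftrightarrow> y \<in> (Ran i)\<^sup>\<bottom>"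
proof
  assume "T i y = 0"
  then have "orth_proj (Ran i) y = 0"
    using S_T[of i y] bounded_operator_zero[OF S_bounded subspace_Z] by simp
  then show "y \<in> (Ran i)\<^sup>\<bottom>"
    using orth_proj_diff[OF Ran_subspace[of i] complete_range, of y] by simp
next
  assume "y \<in> (Ran i)\<^sup>\<bottom>"
  then have "orth_proj (Ran i) y = 0"
    by (intro orth_proj_unique[OF Ran_subspace]) (simp_all add: subspace_0[OF Ran_subspace])
  then have "T i y \<in> Ker (i - 1)"
    using S_T[of i y] T_mem[of i y] by (simp add: kernel_on_def)
  then show "T i y = 0"
    using T_mem(2) by (rule orthogonal_comp_disjoint)
qed

lemma T_T: "T i (T (i + 1) y) = 0"
  using orthogonal_comp_anti_mono[OF Ran_subset_Ker, of i] T_mem'(2)[of i y]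
  by (auto simp: T_eq_0_iff)

end

section \<open>The BGG complex as a deformation retract\<close>

locale bgg_twist = closed_range_twist Z d S
  for Z :: "int \<Rightarrow> 'v::real_inner set" and d S :: "int \<Rightarrow> 'v \<Rightarrow> 'v" +
  fixes m :: nat
  assumes nilpotent: "y \<in> Z (i - 1) \<Longrightarrow> ((bgg_T Z S i \<circ> d (i - 1)) ^^ m) y = 0"
begin

abbreviation G where "G \<equiv> bgg_G Z d S"
abbreviation A where "A \<equiv> bgg_A Z d S"
abbreviation B where "B \<equiv> bgg_B Z d S"
abbreviation D where "D \<equiv> bgg_D Z d S"
abbreviation \<Upsilon> where "\<Upsilon> \<equiv> bgg_space Z S"
abbreviation P where "P i \<equiv> orth_proj (\<Upsilon> i)"

lemma Td_funpow_mem: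
  "y \<in> Z (i - 1) \<Longrightarrow> ((T i \<circ> d (i - 1)) ^^ k) y \<in> Z (i - 1)"
  by (induction k) (simp_all add: T_mem)

lemma Td_funpow_zero: "((T i \<circ> d (i - 1)) ^^ k) 0 = 0"
  by (induction k) (simp_all add: bounded_operator_zero[OF d_bounded subspace_Z] T_zero)

lemma Td_funpow_vanishes:
  assumes "y \<in> Z (i - 1)" "m \<le> k"
  shows "((T i \<circ> d (i - 1)) ^^ k) y = 0"
proof -
  have "((T i \<circ> d (i - 1)) ^^ (k - m + m)) y =
      ((T i \<circ> d (i - 1)) ^^ (k - m)) (((T i \<circ> d (i - 1)) ^^ m) y)"
    by (simp only: funpow_add comp_apply)
  also have "\<dots> = 0"
    by (simp only: nilpotent[OF assms(1)] Td_funpow_zero)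
  finally show ?thesis
    using assms(2) by simp
qed

lemma G_finite: "G i y = - (\<Sum>k<m. ((T i \<circ> d (i - 1)) ^^ k) (T i y))"
  unfolding bgg_G_def by (subst suminf_finite[of "{..<m}"]) (auto simp: Td_funpow_vanishes T_mem)

lemma Td_bounded: "bounded_operator (Z (i - 1)) (Z (i - 1)) (T i \<circ> d (i - 1))"
  unfolding o_def by (rule bounded_operator_compose[OF d_bounded' T_bounded_Z])

lemma G_bounded: "bounded_operator (Z i) (Z (i - 1)) (G i)"
  unfolding G_finite[abs_def]
  by (intro bounded_operator_uminus_fun bounded_operator_sum_fun
      bounded_operator_compose[OF T_bounded_Z bounded_operator_funpow[OF Td_bounded]] subspace_Z)

lemma G_bounded': "bounded_operator (Z (i + 1)) (Z i) (G (i + 1))"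
  using G_bounded[of "i + 1"] by simp

lemma G_T: "G i (T (i + 1) y) = 0"
  unfolding G_finite T_T Td_funpow_zero by simp

text \<open>
  The geometric series satisfies the two recursions \<open>G = - T + T d G\<close> and \<open>G = - T + G d T\<close>,
  according to whether a factor is split off on the left or on the right. They are what connects
  \<open>G\<close> with the differential.
\<close>

lemma G_left:
  assumes "y \<in> Z i"
  shows "G i y = T i (d (i - 1) (G i y) - y)"
proof -
  let ?s = "\<lambda>k. ((T i \<circ> d (i - 1)) ^^ k) (T i y)"
  have mem: "?s k \<in> Z (i - 1)" for k
    by (rule Td_funpow_mem[OF T_mem(1)])
  have "T i (d (i - 1) (G i y)) = (T i \<circ> d (i - 1)) (- (\<Sum>k<m. ?s k))"
    by (simp add: G_finite)
  also have "\<dots> = - (T i \<circ> d (i - 1)) (\<Sum>k<m. ?s k)"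
    by (rule bounded_operator_uminus[OF Td_bounded subspace_sum[OF subspace_Z mem]])
  also have "(T i \<circ> d (i - 1)) (\<Sum>k<m. ?s k) = (\<Sum>k<m. ?s (Suc k))"
    using bounded_operator_sum[OF Td_bounded subspace_Z mem] by simp
  also have "- (\<Sum>k<m. ?s (Suc k)) = T i y - (\<Sum>k<Suc m. ?s k)"
    by (simp add: sum.lessThan_Suc_shift del: sum.lessThan_Suc)
  also have "\<dots> = T i y + G i y"
    using Td_funpow_vanishes[OF T_mem(1), of m i y] by (simp add: G_finite)
  finally show ?thesis
    by (simp add: T_diff)
qed

lemma G_d_T: "G i (d (i - 1) (T i y)) = T i y + G i y"
proof -
  let ?s = "\<lambda>k. ((T i \<circ> d (i - 1)) ^^ k) (T i y)"
  have "G i (d (i - 1) (T i y)) = - (\<Sum>k<m. ?s (Suc k))"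
    by (simp add: G_finite funpow_swap1 del: funpow.simps) (simp add: funpow_swap1)
  also have "- (\<Sum>k<m. ?s (Suc k)) = T i y - (\<Sum>k<Suc m. ?s k)"
    by (simp add: sum.lessThan_Suc_shift del: sum.lessThan_Suc)
  also have "\<dots> = T i y + G i y"
    using Td_funpow_vanishes[OF T_mem(1), of m i y] by (simp add: G_finite)
  finally show ?thesis .
qed

lemma G_mem:
  assumes "y \<in> Z i"
  shows "G i y \<in> Z (i - 1)" "G i y \<in> (Ker (i - 1))\<^sup>\<bottom>"
  using G_left[OF assms] T_mem[of i] by metis+

lemma G_G:
  assumes "y \<in> Z (i + 1)"
  shows "G i (G (i + 1) y) = 0"
  by (metis G_left[OF assms] G_T)

lemma G_cong_T: "T i x = T i y \<Longrightarrow> G i x = G i y"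
  by (simp add: G_finite)

lemma G_eq_0_iff:
  assumes "y \<in> Z i"
  shows "G i y = 0 \<longleftrightarrow> T i y = 0"
proof
  assume "G i y = 0"
  then have "T i (0 - y) = 0"
    using G_left[OF assms] bounded_operator_zero[OF d_bounded subspace_Z] by simp
  then show "T i y = 0"
    unfolding T_diff T_zero by simp
qed (simp add: G_finite Td_funpow_zero del: funpow.simps)

text \<open>
  By the right recursion \<open>G d T = T + G\<close>, and \<open>G S T = G\<close> because \<open>G\<close> depends on \<open>y\<close> only through
  \<open>T y\<close> and \<open>T S T = T\<close>.
\<close>

lemma G_dV_T:
  assumes "y \<in> Z i"
  shows "G i (dV (i - 1) (T i y)) = T i y"
proof -
  have "G i (S (i - 1) (T i y)) = G i y"
    by (rule G_cong_T) (simp add: T_S T_mem)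
  moreover have "d (i - 1) (T i y) \<in> Z i" "S (i - 1) (T i y) \<in> Z i"
    by (auto intro: bounded_operator_mem[OF d_bounded'] bounded_operator_mem[OF S_bounded'] T_mem)
  ultimately show ?thesis
    using G_d_T[of i y] by (simp add: twisted_d_def bounded_operator_diff[OF G_bounded subspace_Z])
qed

text \<open>
  By the left recursion \<open>T d G = T + G\<close>, and \<open>T S G = G\<close> since \<open>G\<close> takes values in the range of \<open>T\<close>;
  thus \<open>V G y\<close> and \<open>y\<close> have the same image under \<open>T\<close>, and so under \<open>G\<close>.
\<close>

lemma G_dV_G:
  assumes "y \<in> Z i"
  shows "G i (dV (i - 1) (G i y)) = G i y"
proof (rule G_cong_T)
  show "T i (dV (i - 1) (G i y)) = T i y"
    using G_left[OF assms] T_S[OF G_mem[OF assms]] by (simp add: twisted_d_def T_diff algebra_simps)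
qed

text \<open>
  The idempotent endomorphism of the twisted complex that is homotopic to the identity by \<open>G\<close>. It
  equals \<open>A B\<close>, see \<open>A_B\<close>.
\<close>

definition Q where "Q i x = x - G (i + 1) (dV i x) - dV (i - 1) (G i x)"

lemma dV_mem: "x \<in> Z i \<Longrightarrow> dV i x \<in> Z (i + 1)" "x \<in> Z (i - 1) \<Longrightarrow> dV (i - 1) x \<in> Z i"
  by (auto intro: bounded_operator_mem[OF dV_bounded] bounded_operator_mem[OF dV_bounded'])

lemma G_mem': "y \<in> Z (i + 1) \<Longrightarrow> G (i + 1) y \<in> Z i"
  by (rule bounded_operator_mem[OF G_bounded'])

lemma Q_bounded: "bounded_operator (Z i) (Z i) (Q i)"
  unfolding Q_def[abs_def]
  by (intro bounded_operator_diff_fun bounded_operator_id subspace_Z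
      bounded_operator_compose[OF dV_bounded G_bounded']
      bounded_operator_compose[OF G_bounded dV_bounded'])

lemma dV_dV: "x \<in> Z i \<Longrightarrow> dV (i + 1) (dV i x) = 0" "x \<in> Z (i - 1) \<Longrightarrow> dV i (dV (i - 1) x) = 0"
  by (auto intro: hilbert_complex_square[OF hilbert_complex_twisted]
      hilbert_complex_square'[OF hilbert_complex_twisted])

lemma dV_Q:
  assumes "x \<in> Z i"
  shows "dV i (Q i x) = Q (i + 1) (dV i x)"
proof -
  have "dV i (Q i x) = dV i x - dV i (G (i + 1) (dV i x))"
    using assms by (simp add: Q_def dV_mem G_mem G_mem' subspace_diff[OF subspace_Z] dV_dV
        bounded_operator_diff[OF dV_bounded subspace_Z])
  also have "\<dots> = Q (i + 1) (dV i x)"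
    using assms bounded_operator_zero[OF G_bounded subspace_Z] by (simp add: Q_def dV_dV)
  finally show ?thesis .
qed

lemma G_Q:
  assumes "x \<in> Z i"
  shows "G i (Q i x) = 0"
  using assms
  by (simp add: Q_def dV_mem G_mem G_mem' subspace_diff[OF subspace_Z] G_G G_dV_G
      bounded_operator_diff[OF G_bounded subspace_Z])

lemma Q_Q:
  assumes "x \<in> Z i"
  shows "Q i (Q i x) = Q i x"
proof -
  have "G (i + 1) (dV i (Q i x)) = 0"
    using assms by (simp add: dV_Q G_Q dV_mem)
  then show ?thesis
    using assms bounded_operator_zero[OF dV_bounded' subspace_Z]
    by (simp add: Q_def[of i "Q i x"] G_Q)
qed

lemma Q_T:
  assumes "y \<in> Z (i + 1)"
  shows "Q i (T (i + 1) y) = 0"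
  using G_dV_T[OF assms] bounded_operator_zero[OF dV_bounded' subspace_Z] by (simp add: Q_def G_T)

text \<open>
  Every element of \<open>(ker S)\<^sup>\<bottom>\<close> has the form \<open>T y\<close>, and \<open>Q T = T - G V T - V G T = 0\<close> because
  \<open>G V T = T\<close> and \<open>G T = 0\<close>.
\<close>

lemma Q_Ker_complement:
  assumes "x \<in> Z i" "x \<in> (Ker i)\<^sup>\<bottom>"
  shows "Q i x = 0"
  using Q_T[of "S i x" i] T_S[of x "i + 1"] assms bounded_operator_mem[OF S_bounded] by simp

lemma bgg_space:
  shows bgg_space_subspace: "subspace (\<Upsilon> i)" and bgg_space_complete: "complete (\<Upsilon> i)"
  unfolding bgg_space_def Int_commute[of "(Ran i)\<^sup>\<bottom>"]
  by (simp_all add: Ker_subspace subspace_inter subspace_orthogonal_comp complete_Int_closed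
      Ker_complete closed_orthogonal_comp)

lemma bgg_spaceD:
  assumes "x \<in> \<Upsilon> i"
  shows "x \<in> Z i" "G i x = 0"
proof -
  show Z: "x \<in> Z i"
    using assms by (simp add: bgg_space_def kernel_on_def)
  show "G i x = 0"
    using assms by (simp add: G_eq_0_iff[OF Z] T_eq_0_iff) (simp add: bgg_space_def)
qed

lemma P_bounded: "bounded_operator (Z i) (\<Upsilon> i) (P i)"
  by (rule bounded_operator_subset[OF bounded_operator_orth_proj[OF bgg_space]])
    (simp_all add: orth_proj_mem[OF bgg_space])

lemma P_diff: "P i (x - y) = P i x - P i y"
  by (rule bounded_operator_diff[OF bounded_operator_orth_proj[OF bgg_space] subspace_UNIV]) auto

lemma P_bgg_space: "x \<in> \<Upsilon> i \<Longrightarrow> P i x = x"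
  by (rule orth_proj_unique[OF bgg_space_subspace])
    (simp_all add: subspace_0[OF subspace_orthogonal_comp])

lemma P_Ker_complement:
  assumes "x \<in> (Ker i)\<^sup>\<bottom>"
  shows "P i x = 0"
proof (rule orth_proj_unique[OF bgg_space_subspace])
  show "x - 0 \<in> (\<Upsilon> i)\<^sup>\<bottom>"
    using assms orthogonal_comp_anti_mono[of "\<Upsilon> i" "Ker i"] by (auto simp: bgg_space_def)
qed (simp add: subspace_0[OF bgg_space_subspace])

text \<open>
  Within \<open>(ran S)\<^sup>\<bottom>\<close> the projection to \<open>\<Upsilon> = (ran S)\<^sup>\<bottom> \<inter> ker S\<close> agrees with the projection to
  \<open>ker S\<close>, which does not leave \<open>(ran S)\<^sup>\<bottom>\<close> since \<open>(ker S)\<^sup>\<bottom>\<close> is contained in it.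
\<close>

lemma P_remainder:
  assumes "x \<in> Z i" "x \<in> (Ran i)\<^sup>\<bottom>"
  shows "x - P i x \<in> (Ker i)\<^sup>\<bottom>"
proof -
  define k where "k = orth_proj (Ker i) x"
  have k: "k \<in> Ker i" "x - k \<in> (Ker i)\<^sup>\<bottom>"
    unfolding k_def by (rule orth_proj[OF Ker_subspace Ker_complete])+
  have "x - k \<in> (Ran i)\<^sup>\<bottom>"
    using k(2) orthogonal_comp_anti_mono[OF Ran_subset_Ker] by blast
  from subspace_diff[OF subspace_orthogonal_comp assms(2) this]
  have "k \<in> \<Upsilon> i"
    using k(1) by (simp add: bgg_space_def)
  moreover have "P i (x - k) = 0"
    by (rule P_Ker_complement[OF k(2)])
  ultimately show ?thesis
    using k(2) P_bgg_space by (simp add: P_diff)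
qed

text \<open>
  An element annihilated by \<open>G\<close> is orthogonal to the range of \<open>S\<close>. It then differs from its projection
  by an element of \<open>(ker S)\<^sup>\<bottom>\<close>, on which \<open>Q\<close> vanishes.
\<close>

lemma Q_P:
  assumes "x \<in> Z i" "G i x = 0"
  shows "Q i (P i x) = Q i x"
proof -
  have P: "P i x \<in> Z i"
    using bounded_operator_mem[OF P_bounded assms(1)] by (rule bgg_spaceD)
  have "Q i (x - P i x) = 0"
    using assms P by (intro Q_Ker_complement P_remainder)
      (simp_all add: subspace_diff[OF subspace_Z] G_eq_0_iff T_eq_0_iff)
  then show ?thesis
    using bounded_operator_diff[OF Q_bounded subspace_Z assms(1) P] by simp
qed

lemma A_eq: "x \<in> \<Upsilon> i \<Longrightarrow> A i x = Q i x"
  using bgg_spaceD[of x i] bounded_operator_zero[OF dV_bounded' subspace_Z] by (simp add: bgg_A_def Q_def)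

lemma B_eq:
  assumes "x \<in> Z i"
  shows "B i x = P i (Q i x)"
proof -
  have "G (i + 1) (dV i x) \<in> (Ker i)\<^sup>\<bottom>"
    using G_mem(2)[of "dV i x" "i + 1"] dV_mem assms by simp
  then show ?thesis
    by (simp add: bgg_B_def Q_def P_diff P_Ker_complement)
qed

lemma A_bounded: "bounded_operator (\<Upsilon> i) (Z i) (A i)"
proof (rule bounded_operator_cong[OF _ A_eq bgg_space_subspace])
  show "bounded_operator (\<Upsilon> i) (Z i) (Q i)"
    by (rule bounded_operator_subset[OF Q_bounded])
      (use bgg_spaceD bounded_operator_mem[OF Q_bounded] in auto)
qed

lemma B_bounded: "bounded_operator (Z i) (\<Upsilon> i) (B i)"
  by (rule bounded_operator_cong[OF bounded_operator_compose[OF Q_bounded P_bounded] B_eq subspace_Z])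

text \<open>
  Elements of the range of \<open>Q\<close> are annihilated by \<open>G\<close>, so that \<open>Q P Q = Q Q = Q\<close>.
\<close>

lemma A_B:
  assumes "x \<in> Z i"
  shows "A i (B i x) = Q i x"
  using assms bounded_operator_mem[OF B_bounded assms] bounded_operator_mem[OF Q_bounded assms]
  by (simp add: A_eq) (simp add: B_eq Q_P G_Q Q_Q)

text \<open>
  \<open>P Q = P (1 - G V)\<close> on \<open>\<Upsilon>\<close>, and \<open>P G = 0\<close> because \<open>G\<close> takes values in \<open>(ker S)\<^sup>\<bottom>\<close>.
\<close>

lemma B_A:
  assumes "x \<in> \<Upsilon> i"
  shows "B i (A i x) = x"
proof -
  note x = bgg_spaceD[OF assms]
  have "B i (A i x) = P i (Q i x)"
    using assms x by (simp add: A_eq B_eq Q_Q bounded_operator_mem[OF Q_bounded])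
  also have "\<dots> = P i x - P i (G (i + 1) (dV i x))"
    using x bounded_operator_zero[OF dV_bounded' subspace_Z] by (simp add: Q_def P_diff)
  also have "P i (G (i + 1) (dV i x)) = 0"
    using G_mem(2)[of "dV i x" "i + 1"] dV_mem x by (simp add: P_Ker_complement)
  finally show ?thesis
    using P_bgg_space[OF assms] by simp
qed

text \<open>
  The projection in the definition of \<open>D\<close> may be replaced by \<open>B = P Q\<close>, since \<open>V A\<close> already takes
  values in the range of \<open>Q\<close>.
\<close>

lemma D_eq:
  assumes "x \<in> \<Upsilon> i"
  shows "D i x = B (i + 1) (dV i (A i x))"
proof -
  have x: "x \<in> Z i" "Q i x \<in> Z i"
    using bgg_spaceD[OF assms] bounded_operator_mem[OF Q_bounded] by auto
  then have "B (i + 1) (dV i (A i x)) = P (i + 1) (dV i (Q i x))"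
    using assms by (simp add: A_eq B_eq dV_mem dV_Q[symmetric] Q_Q)
  then show ?thesis
    using assms by (simp add: bgg_D_def A_eq)
qed

lemma A_mem: "x \<in> \<Upsilon> i \<Longrightarrow> A i x \<in> Z i" and B_mem: "y \<in> Z i \<Longrightarrow> B i y \<in> \<Upsilon> i"
  by (auto intro: bounded_operator_mem[OF A_bounded] bounded_operator_mem[OF B_bounded])

lemma Q_A: "x \<in> \<Upsilon> i \<Longrightarrow> Q i (A i x) = A i x"
  by (simp add: A_eq Q_Q bgg_spaceD)

lemma complex_map_A: "complex_map \<Upsilon> D Z dV A"
  unfolding complex_map_def
proof (intro conjI allI ballI A_bounded)
  show "dV i (A i x) = A (i + 1) (D i x)" if "x \<in> \<Upsilon> i" for i x
    using that by (simp add: D_eq A_B A_mem dV_mem dV_Q[symmetric] Q_A)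
qed

lemma complex_map_B: "complex_map Z dV \<Upsilon> D B"
  unfolding complex_map_def
proof (intro conjI allI ballI B_bounded)
  show "D i (B i y) = B (i + 1) (dV i y)" if "y \<in> Z i" for i y
    using that
    by (simp add: D_eq B_mem A_B dV_Q) (simp add: B_eq dV_mem bounded_operator_mem[OF Q_bounded] Q_Q)
qed

lemma hilbert_complex_bgg: "hilbert_complex \<Upsilon> D"
  unfolding hilbert_complex_def hilbert_subspace_def
proof (intro conjI allI ballI bgg_space)
  show "bounded_operator (\<Upsilon> i) (\<Upsilon> (i + 1)) (D i)" for i
    by (rule bounded_operator_cong[OF bounded_operator_compose[OF
            bounded_operator_compose[OF A_bounded dV_bounded] B_bounded] D_eq bgg_space_subspace])
  show "D (i + 1) (D i x) = 0" if "x \<in> \<Upsilon> i" for i x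
  proof -
    have "D (i + 1) (D i x) = B (i + 1 + 1) (dV (i + 1) (dV i (A i x)))"
      using that complex_map_commutes[OF complex_map_B, of "dV i (A i x)" "i + 1"]
      by (simp add: D_eq[OF that] dV_mem A_mem)
    also have "\<dots> = 0"
      using bounded_operator_zero[OF B_bounded subspace_Z] by (simp add: dV_dV A_mem that)
    finally show ?thesis .
  qed
qed

lemma A_B_homotopic:
  assumes "x \<in> kernel_on (Z k) (dV k)"
  shows "A k (B k x) - x \<in> dV (k - 1) ` Z (k - 1)"
proof -
  have x: "x \<in> Z k" "dV k x = 0"
    using assms by (auto simp: kernel_on_def)
  then have "A k (B k x) - x = - dV (k - 1) (G k x)"
    using bounded_operator_zero[OF G_bounded subspace_Z] by (simp add: A_B Q_def)
  also have "\<dots> = dV (k - 1) (- G k x)"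
    using bounded_operator_uminus[OF dV_bounded G_mem(1)[OF x(1)]] by simp
  finally show ?thesis
    using G_mem(1)[OF x(1)] subspace_neg[OF subspace_Z] by blast
qed

lemma B_A_homotopic:
  assumes "x \<in> kernel_on (\<Upsilon> k) (D k)"
  shows "B k (A k x) - x \<in> D (k - 1) ` \<Upsilon> (k - 1)"
  using assms subspace_0[OF subspace_boundaries[OF hilbert_complex_bgg]]
  by (simp add: B_A kernel_on_def)

lemma cohomology_iso:
  shows induced_A_iso: "vs_iso_map (cohomology \<Upsilon> D k) (cohomology Z dV k) (induced_map Z dV A k)"
    and induced_B_iso: "vs_iso_map (cohomology Z dV k) (cohomology \<Upsilon> D k) (induced_map \<Upsilon> D B k)"
    and induced_B_A: "C \<in> vs_carrier (cohomology \<Upsilon> D k) \<Longrightarrow>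
      induced_map \<Upsilon> D B k (induced_map Z dV A k C) = C"
    and induced_A_B: "C' \<in> vs_carrier (cohomology Z dV k) \<Longrightarrow>
      induced_map Z dV A k (induced_map \<Upsilon> D B k C') = C'"
proof -
  note U = hilbert_complex_bgg and V = hilbert_complex_twisted
  note A = complex_map_A and B = complex_map_B
  show "vs_iso_map (cohomology \<Upsilon> D k) (cohomology Z dV k) (induced_map Z dV A k)"
    by (rule induced_map_iso[OF U V A B]) (simp_all only: A_B_homotopic B_A_homotopic)
  show "vs_iso_map (cohomology Z dV k) (cohomology \<Upsilon> D k) (induced_map \<Upsilon> D B k)"
    by (rule induced_map_iso[OF V U B A]) (simp_all only: A_B_homotopic B_A_homotopic)
  show "induced_map \<Upsilon> D B k (induced_map Z dV A k C) = C"
    if "C \<in> vs_carrier (cohomology \<Upsilon> D k)"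
    by (rule induced_map_inverse[OF U V A B _ that]) (rule B_A_homotopic)
  show "induced_map Z dV A k (induced_map \<Upsilon> D B k C') = C'"
    if "C' \<in> vs_carrier (cohomology Z dV k)"
    by (rule induced_map_inverse[OF V U B A _ that]) (rule A_B_homotopic)
qed

end

section \<open>Orthogonal direct sums of bigraded spaces\<close>

lemma total_spaceD: "\<phi> \<in> total_space W i \<Longrightarrow> component \<phi> j \<in> W i j"
  by (simp add: total_space_def)

lemma subspace_total_space:
  assumes "\<And>j. subspace (W i j)"
  shows "subspace (total_space W i)"
  using assms by (auto simp: subspace_def total_space_def)

lemma inner_disjoint_support:
  fixes \<phi> \<psi> :: "('i, 'a::real_inner) dsum"
  assumes "\<And>j. component \<phi> j = 0 \<or> component \<psi> j = 0"
  shows "\<phi> \<bullet> \<psi> = 0"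
  unfolding inner_dsum_def using assms by (intro sum.neutral) (metis inner_zero_left inner_zero_right)

lemma norm_component_le:
  fixes \<phi> :: "('i, 'a::real_inner) dsum"
  shows "norm (component \<phi> j) \<le> norm \<phi>"
proof (rule power2_le_imp_le)
  have "component \<phi> j \<bullet> component \<phi> j \<le>
      (\<Sum>i\<in>insert j {i. component \<phi> i \<noteq> 0}. component \<phi> i \<bullet> component \<phi> i)"
    by (rule member_le_sum) (auto simp: finite_component)
  also have "\<dots> = \<phi> \<bullet> \<phi>"
    by (rule inner_dsum_superset[symmetric]) (auto simp: finite_component)
  finally show "(norm (component \<phi> j))\<^sup>2 \<le> (norm \<phi>)\<^sup>2"
    by (simp add: power2_norm_eq_inner)
qed simp

lemma norm_le_sum_components:
  fixes \<phi> :: "('i, 'a::real_inner) dsum"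
  assumes "finite J" "\<And>j. j \<notin> J \<Longrightarrow> component \<phi> j = 0"
  shows "norm \<phi> \<le> (\<Sum>j\<in>J. norm (component \<phi> j))"
proof -
  have "norm \<phi> = L2_set (\<lambda>j. norm (component \<phi> j)) J"
    using inner_dsum_superset[of J \<phi> \<phi>] assms
    by (auto simp: norm_dsum_def L2_set_def power2_norm_eq_inner)
  also have "\<dots> \<le> (\<Sum>j\<in>J. norm (component \<phi> j))"
    by (rule L2_set_le_sum) simp
  finally show ?thesis .
qed

text \<open>
  Convergence in a finite direct sum is componentwise convergence; the norm is dominated by the
  finite sum of the norms of the components.
\<close>

lemma complete_total_space:
  fixes W :: "int \<Rightarrow> int \<Rightarrow> 'a::real_inner set"
  assumes W: "\<And>j. complete (W i j)" and J: "finite J" "\<And>j. j \<notin> J \<Longrightarrow> W i j = {0}"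
  shows "complete (total_space W i)"
  unfolding complete_def
proof (intro allI impI)
  fix X assume "(\<forall>n. X n \<in> total_space W i) \<and> Cauchy X"
  then have X: "\<And>n j. component (X n) j \<in> W i j" and "Cauchy X"
    by (auto simp: total_spaceD)
  have "Cauchy (\<lambda>n. component (X n) j)" for j
  proof (rule metric_CauchyI)
    fix e :: real assume "0 < e"
    then obtain M where "\<And>m n. M \<le> m \<Longrightarrow> M \<le> n \<Longrightarrow> dist (X m) (X n) < e"
      using metric_CauchyD[OF \<open>Cauchy X\<close>] by blast
    moreover have "dist (component (X m) j) (component (X n) j) \<le> dist (X m) (X n)" for m n
      using norm_component_le[of "X m - X n" j] by (simp add: dist_norm)
    ultimately show "\<exists>M. \<forall>m\<ge>M. \<forall>n\<ge>M. dist (component (X m) j) (component (X n) j) < e"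
      by (meson order.strict_trans1)
  qed
  then have "\<exists>l\<in>W i j. (\<lambda>n. component (X n) j) \<longlonglongrightarrow> l" for j
    using spec[OF W[of j, unfolded complete_def], of "\<lambda>n. component (X n) j"] X by simp
  then obtain l where l: "\<And>j. l j \<in> W i j" "\<And>j. (\<lambda>n. component (X n) j) \<longlonglongrightarrow> l j"
    by metis
  have l0: "l j = 0" if "j \<notin> J" for j
    using l(1)[of j] J(2)[OF that] by simp
  have comp: "component (Dsum l) j = l j" for j
    by (subst component_Dsum) (auto intro: finite_subset[OF _ J(1)] l0)
  have "X \<longlonglongrightarrow> Dsum l"
  proof (rule LIM_zero_cancel, rule Lim_null_comparison)
    have X0: "component (X n) j = 0" if "j \<notin> J" for n j
      using X[of n j] J(2)[OF that] by simp
    show "\<forall>\<^sub>F n in sequentially. norm (X n - Dsum l) \<le> (\<Sum>j\<in>J. norm (component (X n) j - l j))"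
    proof (rule always_eventually, rule allI)
      fix n
      show "norm (X n - Dsum l) \<le> (\<Sum>j\<in>J. norm (component (X n) j - l j))"
        using norm_le_sum_components[OF J(1), of "X n - Dsum l"] by (simp add: comp X0 l0)
    qed
    have "(\<lambda>n. \<Sum>j\<in>J. norm (component (X n) j - l j)) \<longlonglongrightarrow> (\<Sum>j\<in>J. norm (l j - l j))"
      by (intro tendsto_intros l(2))
    then show "(\<lambda>n. \<Sum>j\<in>J. norm (component (X n) j - l j)) \<longlonglongrightarrow> 0"
      by simp
  qed
  moreover have "Dsum l \<in> total_space W i"
    by (simp add: total_space_def comp l(1))
  ultimately show "\<exists>l\<in>total_space W i. X \<longlonglongrightarrow> l" by blast
qed

locale graded_hilbert =
  fixes Z :: "int \<Rightarrow> int \<Rightarrow> 'a::real_inner set" and N :: nat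
  assumes Z_subspace: "subspace (Z i j)"
    and Z_complete: "complete (Z i j)"
    and Z_outside: "\<not> (0 \<le> j \<and> j \<le> int N) \<Longrightarrow> Z i j = {0}"
begin

abbreviation ZT where "ZT \<equiv> total_space Z"

lemma ZT_subspace: "subspace (ZT i)"
  by (rule subspace_total_space) (rule Z_subspace)

lemma ZT_complete: "complete (ZT i)"
  by (rule complete_total_space[of _ _ "{0..int N}"]) (simp_all add: Z_complete Z_outside)

lemma component_mem: "\<phi> \<in> ZT i \<Longrightarrow> component \<phi> j \<in> Z i j"
  by (rule total_spaceD)

text \<open>
  The values of \<open>Dsum\<close> are specified only for finitely supported families; families in \<open>Z i\<close> are
  supported in \<open>{0..N}\<close>.
\<close>

lemma component_family:
  assumes "\<And>j. l j \<in> Z i j"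
  shows "component (Dsum l) j = l j"
proof -
  have "finite {j. l j \<noteq> 0}"
    by (rule finite_subset[of _ "{0..int N}"]) (use assms Z_outside in force)+
  then show ?thesis
    by (simp add: component_Dsum)
qed

text \<open>
  The diagonal operator \<open>total_d\<close> and the shift \<open>total_S\<close> are the cases \<open>s = 0\<close> and \<open>s = 1\<close>.
\<close>

context
  fixes f :: "int \<Rightarrow> 'a \<Rightarrow> 'a" and i i' s :: int
  assumes f: "\<And>j. bounded_operator (Z i (j + s)) (Z i' j) (f j)"
begin

lemma component_total:
  assumes "\<phi> \<in> ZT i"
  shows "component (Dsum (\<lambda>j. f j (component \<phi> (j + s)))) j = f j (component \<phi> (j + s))"
  by (rule component_family) (rule bounded_operator_mem[OF f component_mem[OF assms]])

lemma bounded_operator_total: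
  "bounded_operator (ZT i) (ZT i') (\<lambda>\<phi>. Dsum (\<lambda>j. f j (component \<phi> (j + s))))"
  unfolding bounded_operator_def
proof (intro conjI ballI allI)
  show mem: "(\<lambda>\<phi>. Dsum (\<lambda>j. f j (component \<phi> (j + s)))) \<in> ZT i \<rightarrow> ZT i'"
  proof
    fix \<phi> assume \<phi>: "\<phi> \<in> ZT i"
    show "Dsum (\<lambda>j. f j (component \<phi> (j + s))) \<in> ZT i'"
      using bounded_operator_mem[OF f component_mem[OF \<phi>]]
      by (simp add: total_space_def[of Z i'] component_total[OF \<phi>])
  qed
  show "Dsum (\<lambda>j. f j (component (\<phi> + \<psi>) (j + s))) =
      Dsum (\<lambda>j. f j (component \<phi> (j + s))) + Dsum (\<lambda>j. f j (component \<psi> (j + s)))"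
    if "\<phi> \<in> ZT i" "\<psi> \<in> ZT i" for \<phi> \<psi>
  proof (rule dsum_eqI)
    show "component (Dsum (\<lambda>j. f j (component (\<phi> + \<psi>) (j + s)))) j =
      component (Dsum (\<lambda>j. f j (component \<phi> (j + s))) + Dsum (\<lambda>j. f j (component \<psi> (j + s)))) j" for j
      using component_total[OF subspace_add[OF ZT_subspace that]]
      by (simp add: component_total that bounded_operator_add[OF f] component_mem)
  qed
  show "Dsum (\<lambda>j. f j (component (c *\<^sub>R \<phi>) (j + s))) = c *\<^sub>R Dsum (\<lambda>j. f j (component \<phi> (j + s)))"
    if "\<phi> \<in> ZT i" for c \<phi>
  proof (rule dsum_eqI)
    show "component (Dsum (\<lambda>j. f j (component (c *\<^sub>R \<phi>) (j + s)))) j =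
      component (c *\<^sub>R Dsum (\<lambda>j. f j (component \<phi> (j + s)))) j" for j
      using component_total[OF subspace_scale[OF ZT_subspace that]]
      by (simp add: component_total that bounded_operator_scaleR[OF f] component_mem)
  qed
  have "\<forall>j. \<exists>C>0. \<forall>x\<in>Z i (j + s). norm (f j x) \<le> C * norm x"
    using bounded_operator_pos_bound[OF f] by metis
  then obtain C where C: "\<And>j. C j > 0" "\<And>j x. x \<in> Z i (j + s) \<Longrightarrow> norm (f j x) \<le> C j * norm x"
    by metis
  have "norm (Dsum (\<lambda>j. f j (component \<phi> (j + s)))) \<le> (\<Sum>j\<in>{0..int N}. C j) * norm \<phi>"
    if \<phi>: "\<phi> \<in> ZT i" for \<phi>
  proof -
    have "norm (Dsum (\<lambda>j. f j (component \<phi> (j + s)))) \<le>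
        (\<Sum>j\<in>{0..int N}. norm (component (Dsum (\<lambda>j. f j (component \<phi> (j + s)))) j))"
    proof (rule norm_le_sum_components)
      fix j assume "j \<notin> {0..int N}"
      then show "component (Dsum (\<lambda>j. f j (component \<phi> (j + s)))) j = 0"
        using funcset_mem[OF mem \<phi>, THEN component_mem, of j] Z_outside[of j i'] by auto
    qed simp
    also have "\<dots> \<le> (\<Sum>j\<in>{0..int N}. C j * norm \<phi>)"
    proof (rule sum_mono)
      fix j
      have "norm (f j (component \<phi> (j + s))) \<le> C j * norm (component \<phi> (j + s))"
        by (rule C(2)[OF component_mem[OF \<phi>]])
      also have "\<dots> \<le> C j * norm \<phi>"
        using C(1)[of j] by (intro mult_left_mono norm_component_le) simp
      finally show "norm (component (Dsum (\<lambda>j. f j (component \<phi> (j + s)))) j) \<le> C j * norm \<phi>"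
        by (simp add: component_total[OF \<phi>])
    qed
    finally show ?thesis
      by (simp add: sum_distrib_right)
  qed
  then show "\<exists>C. \<forall>\<phi>\<in>ZT i. norm (Dsum (\<lambda>j. f j (component \<phi> (j + s)))) \<le> C * norm \<phi>"
    by blast
qed

end

lemma total_diagonal:
  assumes "\<And>j. bounded_operator (Z i j) (Z i' j) (d i j)"
  shows component_total_d: "\<phi> \<in> ZT i \<Longrightarrow> component (total_d d i \<phi>) j = d i j (component \<phi> j)"
    and bounded_operator_total_d: "bounded_operator (ZT i) (ZT i') (total_d d i)"
  using component_total[of i 0 i' "d i"] bounded_operator_total[of i 0 i' "d i"] assms
  by (simp_all add: total_d_def[abs_def])

lemma total_shift:
  assumes "\<And>j. bounded_operator (Z i j) (Z i' (j - 1)) (S i j)"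
  shows component_total_S:
      "\<phi> \<in> ZT i \<Longrightarrow> component (total_S S i \<phi>) j = S i (j + 1) (component \<phi> (j + 1))"
    and bounded_operator_total_S: "bounded_operator (ZT i) (ZT i') (total_S S i)"
  using component_total[of i 1 i' "\<lambda>j. S i (j + 1)"] bounded_operator_total[of i 1 i' "\<lambda>j. S i (j + 1)"]
    assms[of "_ + 1"]
  by (simp_all add: total_S_def[abs_def])

lemma hilbert_complex_total:
  assumes "\<And>j. hilbert_complex (\<lambda>i. Z i j) (\<lambda>i. d i j)"
  shows "hilbert_complex ZT (total_d d)"
proof -
  have d: "bounded_operator (Z i j) (Z (i + 1) j) (d i j)" for i j
    using hilbert_complex_bounded[OF assms, of i j] .
  have bounded: "bounded_operator (ZT i) (ZT (i + 1)) (total_d d i)" for i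
    by (rule bounded_operator_total_d) (rule d)
  have comp: "component (total_d d i \<phi>) j = d i j (component \<phi> j)" if "\<phi> \<in> ZT i" for i j \<phi>
    by (rule component_total_d[OF _ that]) (rule d)
  have "total_d d (i + 1) (total_d d i \<phi>) = 0" if "\<phi> \<in> ZT i" for i \<phi>
    using that bounded_operator_mem[OF bounded that] hilbert_complex_square[OF assms]
    by (intro dsum_eqI) (simp add: comp component_mem)
  then show ?thesis
    using bounded ZT_subspace ZT_complete
    by (simp add: hilbert_complex_def hilbert_subspace_def)
qed

end

section \<open>The twisted complex of a bigraded family\<close>

locale bigraded_bgg = graded_hilbert Z N
  for Z :: "int \<Rightarrow> int \<Rightarrow> 'a::real_inner set" and N :: nat +
  fixes d S :: "int \<Rightarrow> int \<Rightarrow> 'a \<Rightarrow> 'a"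
  assumes complexes: "hilbert_complex (\<lambda>i. Z i j) (\<lambda>i. d i j)"
    and S_bounded: "bounded_operator (Z i j) (Z (i + 1) (j - 1)) (S i j)"
    and S_d: "x \<in> Z i j \<Longrightarrow> S (i + 1) j (d i j x) = - d (i + 1) (j - 1) (S i j x)"
    and S_S: "x \<in> Z i j \<Longrightarrow> S (i + 1) (j - 1) (S i j x) = 0"
begin

abbreviation dT where "dT \<equiv> total_d d"
abbreviation ST where "ST \<equiv> total_S S"

lemma dij_bounded: "bounded_operator (Z i j) (Z (i + 1) j) (d i j)"
  using hilbert_complex_bounded[OF complexes, of i j] .

lemma dT_bounded: "bounded_operator (ZT i) (ZT (i + 1)) (dT i)"
  by (rule bounded_operator_total_d) (rule dij_bounded)

lemma ST_bounded: "bounded_operator (ZT i) (ZT (i + 1)) (ST i)"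
  by (rule bounded_operator_total_S) (rule S_bounded)

lemma component_dT: "\<phi> \<in> ZT i \<Longrightarrow> component (dT i \<phi>) j = d i j (component \<phi> j)"
  by (rule component_total_d) (rule dij_bounded)

lemma component_ST:
  "\<phi> \<in> ZT i \<Longrightarrow> component (ST i \<phi>) j = S i (j + 1) (component \<phi> (j + 1))"
  by (rule component_total_S) (rule S_bounded)

lemma twisted_complex_total: "twisted_complex ZT dT ST"
proof
  show "hilbert_complex ZT dT"
    by (rule hilbert_complex_total[OF complexes])
  show "bounded_operator (ZT i) (ZT (i + 1)) (ST i)" for i
    by (rule ST_bounded)
  fix i \<phi> assume \<phi>: "\<phi> \<in> ZT i"
  have mem: "dT i \<phi> \<in> ZT (i + 1)" "ST i \<phi> \<in> ZT (i + 1)"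
    using \<phi> dT_bounded ST_bounded by (auto dest: bounded_operator_mem)
  show "ST (i + 1) (dT i \<phi>) = - dT (i + 1) (ST i \<phi>)"
  proof (rule dsum_eqI)
    show "component (ST (i + 1) (dT i \<phi>)) j = component (- dT (i + 1) (ST i \<phi>)) j" for j
      using S_d[OF component_mem[OF \<phi>, of "j + 1"]]
      by (simp add: component_dT component_ST \<phi> mem)
  qed
  show "ST (i + 1) (ST i \<phi>) = 0"
  proof (rule dsum_eqI)
    show "component (ST (i + 1) (ST i \<phi>)) j = component 0 j" for j
      using S_S[OF component_mem[OF \<phi>, of "j + 1 + 1"]]
      by (simp only: component_ST[OF mem(2)] component_ST[OF \<phi>] add_diff_cancel_right' component_zero)
  qed
qed

text \<open>
  The truncation to degrees below \<open>m\<close>, the orthogonal projection to one step of the filtration by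
  the second degree.
\<close>

definition low :: "int \<Rightarrow> (int, 'a) dsum \<Rightarrow> (int, 'a) dsum" where
  "low m \<phi> = Dsum (\<lambda>j. if j < m then component \<phi> j else 0)"

lemma component_low: "component (low m \<phi>) j = (if j < m then component \<phi> j else 0)"
proof -
  have "finite {j. (if j < m then component \<phi> j else 0) \<noteq> 0}"
    by (rule finite_subset[OF _ finite_component[of \<phi>]]) auto
  then show ?thesis
    by (simp add: low_def component_Dsum)
qed

lemma low_mem: "\<phi> \<in> ZT i \<Longrightarrow> low m \<phi> \<in> ZT i"
  using subspace_0[OF Z_subspace] by (auto simp: total_space_def component_low)

lemma low_ST:
  assumes "\<phi> \<in> ZT i"
  shows "ST i (low (m + 1) \<phi>) = low m (ST i \<phi>)"
  by (rule dsum_eqI) (simp add: component_ST assms low_mem component_low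
      bounded_operator_zero[OF S_bounded Z_subspace])

lemma low_eq_0:
  assumes "low m \<phi> \<bullet> \<phi> = 0"
  shows "low m \<phi> = 0"
proof -
  have "low m \<phi> \<bullet> (\<phi> - low m \<phi>) = 0"
    by (rule inner_disjoint_support) (simp add: component_low)
  then have "low m \<phi> \<bullet> low m \<phi> = 0"
    using assms by (simp add: inner_diff_right)
  then show ?thesis by simp
qed

lemma low_eq_0_iff: "low m \<phi> = 0 \<longleftrightarrow> (\<forall>j<m. component \<phi> j = 0)"
proof
  assume *: "low m \<phi> = 0"
  show "\<forall>j<m. component \<phi> j = 0"
    using component_low[of m \<phi>] unfolding * by (metis component_zero)
qed (auto intro: dsum_eqI simp: component_low)

end

locale bigraded_bgg_closed = bigraded_bgg Z N d S
  for Z :: "int \<Rightarrow> int \<Rightarrow> 'a::real_inner set" and N d S +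
  assumes S_closed_range: "closed (S i j ` Z i j)"
begin

text \<open>
  The range is again an orthogonal direct sum, so that it inherits completeness from the closed ranges of
  its summands.
\<close>

lemma ST_range: "ST i ` ZT i = total_space (\<lambda>i j. S i (j + 1) ` Z i (j + 1)) i"
proof
  show "ST i ` ZT i \<subseteq> total_space (\<lambda>i j. S i (j + 1) ` Z i (j + 1)) i"
    using component_mem by (auto simp: total_space_def[of "\<lambda>i j. S i (j + 1) ` Z i (j + 1)"] component_ST)
  show "total_space (\<lambda>i j. S i (j + 1) ` Z i (j + 1)) i \<subseteq> ST i ` ZT i"
  proof
    fix \<psi> assume "\<psi> \<in> total_space (\<lambda>i j. S i (j + 1) ` Z i (j + 1)) i"
    then have "\<forall>j. \<exists>x\<in>Z i (j + 1). component \<psi> j = S i (j + 1) x"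
      by (auto simp: total_space_def)
    then obtain x where x: "\<And>j. x j \<in> Z i (j + 1)" "\<And>j. component \<psi> j = S i (j + 1) (x j)"
      by metis
    have comp: "component (Dsum (\<lambda>j. x (j - 1))) j = x (j - 1)" for j
      by (rule component_family) (use x(1)[of "_ - 1"] in simp)
    have mem: "Dsum (\<lambda>j. x (j - 1)) \<in> ZT i"
      using x(1)[of "_ - 1"] by (simp add: total_space_def comp)
    then have "ST i (Dsum (\<lambda>j. x (j - 1))) = \<psi>"
      by (intro dsum_eqI) (simp add: component_ST comp x(2))
    then show "\<psi> \<in> ST i ` ZT i"
      using mem by blast
  qed
qed

lemma complete_ST_range: "complete (ST i ` ZT i)"
  unfolding ST_range
proof (rule complete_total_space[of _ _ "{0..int N}"])
  have sub: "S i (j + 1) ` Z i (j + 1) \<subseteq> Z (i + 1) j" for j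
    using bounded_operator_mem[OF S_bounded[of i "j + 1"]] by auto
  show "complete (S i (j + 1) ` Z i (j + 1))" for j
    using complete_Int_closed[OF Z_complete S_closed_range] sub by (metis Int_absorb1)
  show "S i (j + 1) ` Z i (j + 1) = {0}" if "j \<notin> {0..int N}" for j
    using sub[of j] Z_outside[of j "i + 1"] that bounded_operator_zero[OF S_bounded Z_subspace]
      subspace_0[OF Z_subspace] by fastforce
qed simp

lemma ST_subspace: "subspace (ST i ` ZT i)"
  by (rule subspace_image_bounded_operator[OF ST_bounded ZT_subspace])

text \<open>
  This says that \<open>T\<close> raises the second degree: if \<open>y\<close> has no components below \<open>m\<close>, then \<open>x = T y\<close> has
  none below \<open>m + 1\<close>. The truncation of the projection of \<open>y\<close> lies in the range of \<open>S\<close> and is orthogonal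
  to \<open>y\<close>, so it is zero. Then \<open>S\<close> annihilates the truncation of \<open>x\<close>, which is therefore
  orthogonal to \<open>x\<close> and vanishes as well.
\<close>

lemma low_T:
  assumes y: "low m y = 0"
    and x: "x \<in> ZT i" "x \<in> (kernel_on (ZT i) (ST i))\<^sup>\<bottom>" "ST i x = orth_proj (ST i ` ZT i) y"
  shows "low (m + 1) x = 0"
proof -
  define p where "p = orth_proj (ST i ` ZT i) y"
  have p: "ST i x = p" "y - p \<in> (ST i ` ZT i)\<^sup>\<bottom>"
    unfolding p_def by (rule x(3), rule orth_proj_diff[OF ST_subspace complete_ST_range])
  have "low m p \<in> ST i ` ZT i"
    using low_ST[OF x(1), of m] low_mem[OF x(1), of "m + 1"] p(1) by (metis imageI)
  then have "low m p \<bullet> (y - p) = 0"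
    using orthogonal_compD(1)[OF p(2)] by blast
  moreover have "low m p \<bullet> y = 0"
    by (rule inner_disjoint_support) (use y in \<open>auto simp: low_eq_0_iff component_low\<close>)
  ultimately have "low m p = 0"
    by (intro low_eq_0) (simp add: inner_diff_right)
  then have "low (m + 1) x \<in> kernel_on (ZT i) (ST i)"
    using low_ST[OF x(1), of m] low_mem[OF x(1)] p(1) by (simp add: kernel_on_def)
  then show ?thesis
    by (rule low_eq_0[OF orthogonal_compD(1)[OF x(2)]])
qed

end

context bigraded_bgg_closed
begin

lemma closed_range_twist_total: "closed_range_twist ZT dT ST"
  using twisted_complex_total complete_ST_range
  by (simp add: closed_range_twist_def closed_range_twist_axioms_def)

text \<open>
  Each application of \<open>T d\<close> moves the lowest possible degree up by one, and there are \<open>N + 1\<close> degrees.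
\<close>

lemma bgg_twist_total: "bgg_twist ZT dT ST (N + 1)"
proof -
  interpret closed_range_twist ZT dT ST
    by (rule closed_range_twist_total)
  have low: "low (int k) (((T i \<circ> dT (i - 1)) ^^ k) y) = 0"
    and mem: "((T i \<circ> dT (i - 1)) ^^ k) y \<in> ZT (i - 1)"
    if y: "y \<in> ZT (i - 1)" for i k y
  proof (induction k)
    case 0
    show "((T i \<circ> dT (i - 1)) ^^ 0) y \<in> ZT (i - 1)"
      using y by simp
    show "low (int 0) (((T i \<circ> dT (i - 1)) ^^ 0) y) = 0"
      unfolding low_eq_0_iff
    proof (intro allI impI)
      fix j :: int assume "j < int 0"
      then show "component (((T i \<circ> dT (i - 1)) ^^ 0) y) j = 0"
        using component_mem[OF y, of j] Z_outside[of j "i - 1"] by simp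
    qed
  next
    case (Suc k)
    define x where "x = ((T i \<circ> dT (i - 1)) ^^ k) y"
    have x: "low (int k) x = 0" "x \<in> ZT (i - 1)"
      using Suc unfolding x_def by blast+
    show "((T i \<circ> dT (i - 1)) ^^ Suc k) y \<in> ZT (i - 1)"
      by (simp add: T_mem)
    have "low (int k) (dT (i - 1) x) = 0"
      using x by (simp add: low_eq_0_iff component_dT bounded_operator_zero[OF dij_bounded Z_subspace])
    then have "low (int k + 1) (T i (dT (i - 1) x)) = 0"
      by (rule low_T[OF _ T_mem S_T])
    then show "low (int (Suc k)) (((T i \<circ> dT (i - 1)) ^^ Suc k) y) = 0"
      by (simp add: x_def ac_simps)
  qed
  show ?thesis
  proof
    fix y i assume y: "y \<in> ZT (i - 1)"
    show "((T i \<circ> dT (i - 1)) ^^ (N + 1)) y = 0"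
    proof (rule dsum_eqI)
      fix j
      show "component (((T i \<circ> dT (i - 1)) ^^ (N + 1)) y) j = component 0 j"
        using low[OF y, of "N + 1"] component_mem[OF mem[OF y], of "N + 1" j] Z_outside[of j "i - 1"]
        by (cases "j \<le> int N") (auto simp: low_eq_0_iff)
    qed
  qed
qed

end

section \<open>Untwisting by an exponential\<close>

text \<open>
  A potential \<open>K\<close> for the twist: \<open>S\<close> is the commutator of \<open>d\<close> with \<open>K\<close>, and commutes with \<open>K\<close>.
\<close>

locale untwisting = twisted_complex Z d S
  for Z :: "int \<Rightarrow> 'v::real_inner set" and d S :: "int \<Rightarrow> 'v \<Rightarrow> 'v" +
  fixes K :: "int \<Rightarrow> 'v \<Rightarrow> 'v" and M :: nat
  assumes K_bounded: "bounded_operator (Z i) (Z i) (K i)"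
    and S_K: "x \<in> Z i \<Longrightarrow> S i (K i x) = K (i + 1) (S i x)"
    and S_eq: "x \<in> Z i \<Longrightarrow> S i x = d i (K i x) - K (i + 1) (d i x)"
    and K_nilpotent: "x \<in> Z i \<Longrightarrow> (K i ^^ M) x = 0"
begin

text \<open>
  The operator \<open>exp (t K)\<close>. The term with \<open>k = M\<close> is zero; with it the sum contains the identity
  also when \<open>M = 0\<close>.
\<close>

definition expK :: "real \<Rightarrow> int \<Rightarrow> 'v \<Rightarrow> 'v" where
  "expK t i x = (\<Sum>k\<le>M. (t ^ k / fact k) *\<^sub>R (K i ^^ k) x)"

lemmas K_pow_bounded = bounded_operator_funpow[OF K_bounded]

lemma K_pow_mem: "x \<in> Z i \<Longrightarrow> (K i ^^ k) x \<in> Z i"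
  by (rule bounded_operator_mem[OF K_pow_bounded])

lemma d_S_mem: "x \<in> Z i \<Longrightarrow> d i x \<in> Z (i + 1)" "x \<in> Z i \<Longrightarrow> S i x \<in> Z (i + 1)"
  by (auto intro: bounded_operator_mem[OF d_bounded] bounded_operator_mem[OF S_bounded])

lemma K_pow_vanishes:
  assumes "x \<in> Z i" "M \<le> k"
  shows "(K i ^^ k) x = 0"
proof -
  have "(K i ^^ (k - M + M)) x = (K i ^^ (k - M)) ((K i ^^ M) x)"
    by (simp only: funpow_add comp_apply)
  also have "\<dots> = 0"
    by (simp only: K_nilpotent[OF assms(1)] bounded_operator_zero[OF K_pow_bounded subspace_Z])
  finally show ?thesis
    using assms(2) by simp
qed

lemma expK_bounded: "bounded_operator (Z i) (Z i) (expK t i)"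
  unfolding expK_def[abs_def]
  by (intro bounded_operator_sum_fun bounded_operator_scaleR_fun K_pow_bounded subspace_Z)

lemma S_K_pow: "x \<in> Z i \<Longrightarrow> S i ((K i ^^ k) x) = (K (i + 1) ^^ k) (S i x)"
  by (induction k) (simp_all add: S_K K_pow_mem)

text \<open>
  The Leibniz rule for the commutator of \<open>d\<close> with a power of \<open>K\<close>; since \<open>S\<close> commutes with \<open>K\<close>, its
  terms are all equal.
\<close>

lemma d_K_pow:
  assumes "x \<in> Z i"
  shows "d i ((K i ^^ Suc k) x) =
    (K (i + 1) ^^ Suc k) (d i x) + real (Suc k) *\<^sub>R (K (i + 1) ^^ k) (S i x)"
proof (induction k)
  case 0
  show ?case using S_eq[OF assms] by simp
next
  case (Suc k)
  let ?K = "\<lambda>k. K (i + 1) ^^ k"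
  have "d i ((K i ^^ Suc (Suc k)) x) = K (i + 1) (d i ((K i ^^ Suc k) x)) + S i ((K i ^^ Suc k) x)"
    using S_eq[OF K_pow_mem[OF assms, of "Suc k"]] by simp
  also have "S i ((K i ^^ Suc k) x) = ?K (Suc k) (S i x)"
    by (rule S_K_pow[OF assms])
  also have "K (i + 1) (d i ((K i ^^ Suc k) x)) =
      K (i + 1) (?K (Suc k) (d i x)) + real (Suc k) *\<^sub>R K (i + 1) (?K k (S i x))"
    unfolding Suc
    using K_pow_mem[OF d_S_mem(1)[OF assms], of "Suc k"] K_pow_mem[OF d_S_mem(2)[OF assms], of k]
    by (simp add: bounded_operator_add[OF K_bounded] bounded_operator_scaleR[OF K_bounded]
        subspace_scale[OF subspace_Z] del: funpow.simps)
  also have "K (i + 1) (?K (Suc k) (d i x)) + real (Suc k) *\<^sub>R K (i + 1) (?K k (S i x)) +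
      ?K (Suc k) (S i x) = ?K (Suc (Suc k)) (d i x) + real (Suc (Suc k)) *\<^sub>R ?K (Suc k) (S i x)"
    by (simp only: of_nat_Suc[of "Suc k"] scaleR_left_distrib scaleR_one) simp
  finally show ?case .
qed

text \<open>
  By the Leibniz rule the commutator of \<open>d\<close> with \<open>exp (t K)\<close> is \<open>t exp (t K) S\<close>, because that of
  \<open>d\<close> with \<open>K\<close> is \<open>S\<close>.
\<close>

lemma d_expK:
  assumes x: "x \<in> Z i"
  shows "d i (expK t i x) = expK t (i + 1) (d i x) + t *\<^sub>R expK t (i + 1) (S i x)"
proof -
  let ?c = "\<lambda>k. t ^ k / fact k" and ?K = "\<lambda>k. K (i + 1) ^^ k"
  have c: "?c (Suc k) * real (Suc k) = t * ?c k" for k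
    by (simp del: of_nat_Suc)
  have "d i (expK t i x) = (\<Sum>k\<le>M. ?c k *\<^sub>R d i ((K i ^^ k) x))"
    unfolding expK_def using K_pow_mem[OF x]
    by (simp add: bounded_operator_sum[OF d_bounded subspace_Z] subspace_scale[OF subspace_Z]
        bounded_operator_scaleR[OF d_bounded])
  also have "\<dots> = d i x + (\<Sum>k<M. ?c (Suc k) *\<^sub>R d i ((K i ^^ Suc k) x))"
    by (simp add: lessThan_Suc_atMost[symmetric] sum.lessThan_Suc_shift del: sum.lessThan_Suc)
  also have "\<dots> = (d i x + (\<Sum>k<M. ?c (Suc k) *\<^sub>R ?K (Suc k) (d i x))) +
      (\<Sum>k<M. (?c (Suc k) * real (Suc k)) *\<^sub>R ?K k (S i x))"
    unfolding d_K_pow[OF x] by (simp only: scaleR_add_right sum.distrib scaleR_scaleR add.assoc)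
  also have "d i x + (\<Sum>k<M. ?c (Suc k) *\<^sub>R ?K (Suc k) (d i x)) = expK t (i + 1) (d i x)"
    by (simp add: expK_def lessThan_Suc_atMost[symmetric] sum.lessThan_Suc_shift del: sum.lessThan_Suc)
  also have "(\<Sum>k<M. (?c (Suc k) * real (Suc k)) *\<^sub>R ?K k (S i x)) = t *\<^sub>R expK t (i + 1) (S i x)"
    unfolding c using K_nilpotent[OF d_S_mem(2)[OF x]]
    by (simp add: expK_def lessThan_Suc_atMost[symmetric] scaleR_sum_right)
  finally show ?thesis .
qed

lemma S_expK:
  assumes x: "x \<in> Z i"
  shows "S i (expK t i x) = expK t (i + 1) (S i x)"
  unfolding expK_def using K_pow_mem[OF x]
  by (simp add: bounded_operator_sum[OF S_bounded subspace_Z] subspace_scale[OF subspace_Z]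
      bounded_operator_scaleR[OF S_bounded] S_K_pow[OF x])

lemma expK_0: "expK 0 i x = x"
  by (simp add: expK_def sum.atMost_shift)

text \<open>
  The functional equation of the exponential: terms of total degree above \<open>M\<close> vanish, and the others
  are collected by total degree with the binomial theorem.
\<close>

lemma expK_expK:
  assumes x: "x \<in> Z i"
  shows "expK s i (expK t i x) = expK (s + t) i x"
proof -
  let ?c = "\<lambda>t k. t ^ k / fact k"
  have c: "?c (s + t) k = (\<Sum>l\<le>k. ?c s l * ?c t (k - l))" for k
    using exp_series_add_commuting[of s t k] by (simp add: divide_inverse ac_simps)
  have "expK s i (expK t i x) = (\<Sum>k\<le>M. \<Sum>l\<le>M. (?c s k * ?c t l) *\<^sub>R (K i ^^ (k + l)) x)"
    unfolding expK_def using K_pow_mem[OF x]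
    by (simp add: bounded_operator_sum[OF K_pow_bounded subspace_Z] subspace_scale[OF subspace_Z]
        bounded_operator_scaleR[OF K_pow_bounded] scaleR_sum_right funpow_add)
  also have "\<dots> = (\<Sum>(k, l)\<in>{..M} \<times> {..M}. (?c s k * ?c t l) *\<^sub>R (K i ^^ (k + l)) x)"
    by (rule sum.cartesian_product)
  also have "\<dots> = (\<Sum>(k, l)\<in>{(k, l). k + l \<le> M}. (?c s k * ?c t l) *\<^sub>R (K i ^^ (k + l)) x)"
  proof (rule sum.mono_neutral_right)
    show "\<forall>p\<in>{..M} \<times> {..M} - {(k, l). k + l \<le> M}.
        (case p of (k, l) \<Rightarrow> (?c s k * ?c t l) *\<^sub>R (K i ^^ (k + l)) x) = 0"
    proof
      fix p assume p: "p \<in> {..M} \<times> {..M} - {(k, l). k + l \<le> M}"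
      then have "(K i ^^ (fst p + snd p)) x = 0"
        by (intro K_pow_vanishes[OF x]) auto
      then show "(case p of (k, l) \<Rightarrow> (?c s k * ?c t l) *\<^sub>R (K i ^^ (k + l)) x) = 0"
        by (cases p) simp
    qed
  qed auto
  also have "\<dots> = (\<Sum>k\<le>M. \<Sum>l\<le>k. (?c s l * ?c t (k - l)) *\<^sub>R (K i ^^ (l + (k - l))) x)"
    by (rule sum.triangle_reindex_eq)
  also have "\<dots> = (\<Sum>k\<le>M. \<Sum>l\<le>k. (?c s l * ?c t (k - l)) *\<^sub>R (K i ^^ k) x)"
    by (intro sum.cong) auto
  also have "\<dots> = expK (s + t) i x"
    by (simp only: expK_def c scaleR_sum_left)
  finally show ?thesis .
qed

text \<open>
  \<open>exp K\<close> and \<open>exp (- K)\<close> intertwine \<open>d\<close> and \<open>d - S\<close> and are inverse to each other.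
\<close>

lemma twisted_cohomology_isomorphic:
  "vs_isomorphic (cohomology Z dV k) (cohomology Z d k)"
proof (rule vs_isomorphicI, rule induced_map_iso[OF hilbert_complex_twisted complex])
  show "complex_map Z dV Z d (expK (- 1))"
    unfolding complex_map_def
    by (simp add: expK_bounded d_expK twisted_d_def d_S_mem bounded_operator_diff[OF expK_bounded subspace_Z])
  show "complex_map Z d Z dV (expK 1)"
    unfolding complex_map_def by (simp add: expK_bounded d_expK S_expK twisted_d_def)
  show "expK 1 k (expK (- 1) k x) - x \<in> dV (k - 1) ` Z (k - 1)" if "x \<in> kernel_on (Z k) (dV k)" for x
    using that subspace_0[OF subspace_boundaries[OF hilbert_complex_twisted]]
    by (simp add: expK_expK expK_0 kernel_on_def)
  show "expK (- 1) k (expK 1 k x) - x \<in> d (k - 1) ` Z (k - 1)" if "x \<in> kernel_on (Z k) (d k)" for x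
    using that subspace_0[OF subspace_boundaries[OF complex]]
    by (simp add: expK_expK expK_0 kernel_on_def)
qed

end

lemma (in bigraded_bgg) untwisting_total:
  assumes K: "\<And>i j. bounded_operator (Z i j) (Z i (j - 1)) (K i j)"
    and S_K: "\<And>i j x. x \<in> Z i j \<Longrightarrow> S i (j - 1) (K i j x) = K (i + 1) (j - 1) (S i j x)"
    and S_eq: "\<And>i j x. x \<in> Z i j \<Longrightarrow> S i j x = d i (j - 1) (K i j x) - K (i + 1) j (d i j x)"
  shows "untwisting ZT dT ST (total_S K) (N + 1)"
proof -
  let ?K = "total_S K"
  have bounded: "bounded_operator (ZT i) (ZT i) (?K i)" for i
    by (rule bounded_operator_total_S) (rule K)
  have comp: "component (?K i \<phi>) j = K i (j + 1) (component \<phi> (j + 1))" if "\<phi> \<in> ZT i" for i j \<phi>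
    by (rule component_total_S[OF _ that]) (rule K)
  have mem: "dT i \<phi> \<in> ZT (i + 1)" "ST i \<phi> \<in> ZT (i + 1)" "?K i \<phi> \<in> ZT i" if "\<phi> \<in> ZT i" for i \<phi>
    using that by (auto intro: bounded_operator_mem[OF dT_bounded]
        bounded_operator_mem[OF ST_bounded] bounded_operator_mem[OF bounded])
  \<comment> \<open>the component of degree \<open>j\<close> of \<open>K\<^sup>k \<phi>\<close> comes from the component of degree \<open>j + k\<close> of \<open>\<phi>\<close>\<close>
  have vanish: "component ((?K i ^^ k) \<phi>) j = 0" if "\<phi> \<in> ZT i" "j + int k > int N" for i j k \<phi>
    using that(2)
  proof (induction k arbitrary: j)
    case 0
    then show ?case
      using component_mem[OF that(1), of j] Z_outside[of j i] by simp
  next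
    case (Suc k)
    have "(?K i ^^ k) \<phi> \<in> ZT i"
      by (rule bounded_operator_mem[OF bounded_operator_funpow[OF bounded] that(1)])
    then show ?case
      using Suc.IH[of "j + 1"] Suc.prems bounded_operator_zero[OF K Z_subspace] by (simp add: comp)
  qed
  interpret twisted_complex ZT dT ST
    by (rule twisted_complex_total)
  show ?thesis
  proof
    show "bounded_operator (ZT i) (ZT i) (?K i)" for i
      by (rule bounded)
    fix i \<phi> assume \<phi>: "\<phi> \<in> ZT i"
    show "ST i (?K i \<phi>) = ?K (i + 1) (ST i \<phi>)"
    proof (rule dsum_eqI)
      show "component (ST i (?K i \<phi>)) j = component (?K (i + 1) (ST i \<phi>)) j" for j
        using S_K[OF component_mem[OF \<phi>, of "j + 1 + 1"]]
        by (simp only: component_ST[OF mem(3)[OF \<phi>]] comp[OF mem(2)[OF \<phi>]] component_ST[OF \<phi>] comp[OF \<phi>]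
            add_diff_cancel_right')
    qed
    show "ST i \<phi> = dT i (?K i \<phi>) - ?K (i + 1) (dT i \<phi>)"
    proof (rule dsum_eqI)
      show "component (ST i \<phi>) j = component (dT i (?K i \<phi>) - ?K (i + 1) (dT i \<phi>)) j" for j
        using S_eq[OF component_mem[OF \<phi>, of "j + 1"]]
        by (simp add: comp component_ST component_dT \<phi> mem)
    qed
    show "(?K i ^^ (N + 1)) \<phi> = 0"
    proof (rule dsum_eqI)
      fix j
      show "component ((?K i ^^ (N + 1)) \<phi>) j = component 0 j"
        using vanish[OF \<phi>, of j "N + 1"] Z_outside[of j i]
          component_mem[OF bounded_operator_mem[OF bounded_operator_funpow[OF bounded] \<phi>], of "N + 1" j]
        by (cases "0 \<le> j") (simp_all del: funpow.simps)
    qed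
  qed
qed

section \<open>Cohomology of a direct sum\<close>

context graded_hilbert
begin

text \<open>
  The isomorphism sends a class to the family of its componentwise images, which are classes of the
  rows. Cycles and boundaries of the total complex are exactly the families of cycles and boundaries
  of the rows, and rows outside \<open>{0..N}\<close> do not contribute.
\<close>

lemma cohomology_total:
  assumes complexes: "\<And>j. hilbert_complex (\<lambda>i. Z i j) (\<lambda>i. d i j)"
  shows "vs_isomorphic (cohomology ZT (total_d d) k)
    (vs_direct_sum {0..int N} (\<lambda>j. cohomology (\<lambda>i. Z i j) (\<lambda>i. d i j) k))"
proof -
  let ?R = "total_d d (k - 1) ` ZT (k - 1)" and ?r = "\<lambda>j. d (k - 1) j ` Z (k - 1) j"
  let ?Z = "kernel_on (ZT k) (total_d d k)" and ?z = "\<lambda>j. kernel_on (Z k j) (d k j)"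
  let ?J = "{0..int N}"
  define h where "h C = (\<lambda>j\<in>?J. (\<lambda>\<phi>. component \<phi> j) ` C)" for C :: "(int, 'a) dsum set"
  have d: "bounded_operator (Z i j) (Z (i + 1) j) (d i j)" for i j
    using hilbert_complex_bounded[OF complexes, of i j] .
  have comp: "component (total_d d i \<phi>) j = d i j (component \<phi> j)" if "\<phi> \<in> ZT i" for i j \<phi>
    by (rule component_total_d[OF _ that]) (rule d)
  have R: "subspace ?R"
    by (rule subspace_boundaries[OF hilbert_complex_total[OF complexes]])
  have r: "subspace (?r j)" for j
    using subspace_boundaries[OF complexes, of k j] .
  have cycle_iff: "\<phi> \<in> ?Z \<longleftrightarrow> (\<forall>j. component \<phi> j \<in> ?z j)" for \<phi>
  proof
    assume "\<phi> \<in> ?Z"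
    then have "\<phi> \<in> ZT k" "total_d d k \<phi> = 0"
      by (auto simp: kernel_on_def)
    then show "\<forall>j. component \<phi> j \<in> ?z j"
      using comp[of \<phi> k] by (simp add: kernel_on_def component_mem)
  next
    assume *: "\<forall>j. component \<phi> j \<in> ?z j"
    then have "\<phi> \<in> ZT k"
      by (simp add: total_space_def kernel_on_def)
    moreover from this have "total_d d k \<phi> = 0"
      using * by (intro dsum_eqI) (simp add: comp kernel_on_def)
    ultimately show "\<phi> \<in> ?Z"
      by (simp add: kernel_on_def)
  qed
  have boundary_iff: "\<phi> \<in> ?R \<longleftrightarrow> (\<forall>j. component \<phi> j \<in> ?r j)" for \<phi>
  proof
    assume "\<phi> \<in> ?R"
    then show "\<forall>j. component \<phi> j \<in> ?r j"
      using component_mem by (auto simp: comp)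
  next
    assume "\<forall>j. component \<phi> j \<in> ?r j"
    then obtain x where x: "\<And>j. x j \<in> Z (k - 1) j" "\<And>j. component \<phi> j = d (k - 1) j (x j)"
      by (auto simp: image_iff) metis
    have "Dsum x \<in> ZT (k - 1)"
      by (simp add: total_space_def component_family[of x "k - 1"] x(1))
    moreover from this have "\<phi> = total_d d (k - 1) (Dsum x)"
      by (intro dsum_eqI) (simp add: comp component_family[of x "k - 1"] x)
    ultimately show "\<phi> \<in> ?R" by blast
  qed
  have component_coset: "(\<lambda>\<phi>. component \<phi> j) ` (\<phi> +o ?R) = component \<phi> j +o ?r j" for j \<phi>
  proof
    show "(\<lambda>\<phi>. component \<phi> j) ` (\<phi> +o ?R) \<subseteq> component \<phi> j +o ?r j"
      by (auto simp: elt_set_plus_def comp component_mem)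
    show "component \<phi> j +o ?r j \<subseteq> (\<lambda>\<phi>. component \<phi> j) ` (\<phi> +o ?R)"
    proof
      fix y assume "y \<in> component \<phi> j +o ?r j"
      then obtain b where b: "b \<in> ?r j" "y = component \<phi> j + b"
        by (auto simp: elt_set_plus_def)
      \<comment> \<open>a boundary of one row, extended by zero, is a boundary of the total complex\<close>
      define \<psi> where "\<psi> = Dsum (\<lambda>l. if l = j then b else 0)"
      have comp_\<psi>: "component \<psi> l = (if l = j then b else 0)" for l
        unfolding \<psi>_def by (subst component_Dsum) auto
      have "\<psi> \<in> ?R"
        using b(1) subspace_0[OF r] by (auto simp: boundary_iff comp_\<psi>)
      then show "y \<in> (\<lambda>\<phi>. component \<phi> j) ` (\<phi> +o ?R)"
        using b(2) by (intro image_eqI[of _ _ "\<phi> + \<psi>"]) (simp_all add: comp_\<psi> set_plus_intro2)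
    qed
  qed
  have h: "h (\<phi> +o ?R) = (\<lambda>j\<in>?J. component \<phi> j +o ?r j)" for \<phi>
    by (simp add: h_def component_coset)
  have outside: "x \<in> ?r j" if "x \<in> ?z j" "j \<notin> ?J" for x j
    using that Z_outside[of j k] subspace_0[OF r] by (auto simp: kernel_on_def)
  have Z: "subspace ?Z"
    by (rule subspace_cycles[OF hilbert_complex_total[OF complexes]])
  have carrier: "vs_carrier (vs_direct_sum ?J (\<lambda>j. cohomology (\<lambda>i. Z i j) (\<lambda>i. d i j) k)) =
      (\<Pi>\<^sub>E j\<in>?J. (\<lambda>x. x +o ?r j) ` ?z j)"
    by (simp add: vs_direct_sum_def vs_carrier_cohomology)
  have "vs_iso_map (cohomology ZT (total_d d) k)
      (vs_direct_sum ?J (\<lambda>j. cohomology (\<lambda>i. Z i j) (\<lambda>i. d i j) k)) h"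
    unfolding vs_iso_map_def carrier unfolding vs_carrier_cohomology
  proof (intro conjI ballI allI)
    show "bij_betw h ((\<lambda>\<phi>. \<phi> +o ?R) ` ?Z) (\<Pi>\<^sub>E j\<in>?J. (\<lambda>x. x +o ?r j) ` ?z j)"
      unfolding bij_betw_def
    proof
      show "inj_on h ((\<lambda>\<phi>. \<phi> +o ?R) ` ?Z)"
      proof (rule inj_onI, clarsimp)
        fix \<phi> \<psi> assume \<phi>\<psi>: "\<phi> \<in> ?Z" "\<psi> \<in> ?Z" and eq: "h (\<phi> +o ?R) = h (\<psi> +o ?R)"
        have "component (\<phi> - \<psi>) j \<in> ?r j" for j
        proof (cases "j \<in> ?J")
          case True
          then show ?thesis
            using fun_cong[OF eq, of j] by (simp add: h coset_eq_iff[OF r])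
        next
          case False
          show ?thesis
            using subspace_diff[OF Z \<phi>\<psi>] by (intro outside[OF _ False]) (simp only: cycle_iff)
        qed
        then show "\<phi> +o ?R = \<psi> +o ?R"
          unfolding coset_eq_iff[OF R] boundary_iff by blast
      qed
      show "h ` (\<lambda>\<phi>. \<phi> +o ?R) ` ?Z = (\<Pi>\<^sub>E j\<in>?J. (\<lambda>x. x +o ?r j) ` ?z j)"
      proof
        show "h ` (\<lambda>\<phi>. \<phi> +o ?R) ` ?Z \<subseteq> (\<Pi>\<^sub>E j\<in>?J. (\<lambda>x. x +o ?r j) ` ?z j)"
          by (auto simp: h cycle_iff)
        show "(\<Pi>\<^sub>E j\<in>?J. (\<lambda>x. x +o ?r j) ` ?z j) \<subseteq> h ` (\<lambda>\<phi>. \<phi> +o ?R) ` ?Z"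
        proof
          fix F assume F: "F \<in> (\<Pi>\<^sub>E j\<in>?J. (\<lambda>x. x +o ?r j) ` ?z j)"
          have z0: "0 \<in> ?z j" for j
            using subspace_0[OF subspace_cycles[OF complexes, of k j]] .
          have "\<forall>j. \<exists>x\<in>?z j. j \<in> ?J \<longrightarrow> F j = x +o ?r j"
            using F z0 by (fastforce simp: PiE_def Pi_def)
          then obtain x where x: "\<And>j. x j \<in> ?z j" "\<And>j. j \<in> ?J \<Longrightarrow> F j = x j +o ?r j"
            by metis
          have "component (Dsum x) j = x j" for j
            by (rule component_family[of x k]) (use x(1) in \<open>auto simp: kernel_on_def\<close>)
          then have "Dsum x \<in> ?Z" "h (Dsum x +o ?R) j = F j" for j
            using x PiE_arb[OF F, of j] by (simp_all add: cycle_iff h)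
          then have "Dsum x \<in> ?Z" "h (Dsum x +o ?R) = F"
            by blast+
          then show "F \<in> h ` (\<lambda>\<phi>. \<phi> +o ?R) ` ?Z"
            by blast
        qed
      qed
    qed
    show "h (vs_add (cohomology ZT (total_d d) k) C C') =
        vs_add (vs_direct_sum ?J (\<lambda>j. cohomology (\<lambda>i. Z i j) (\<lambda>i. d i j) k)) (h C) (h C')"
      if "C \<in> (\<lambda>\<phi>. \<phi> +o ?R) ` ?Z" "C' \<in> (\<lambda>\<phi>. \<phi> +o ?R) ` ?Z" for C C'
      using that by (auto simp: cohomology_def quotient_add_coset[OF R] h vs_direct_sum_def
          quotient_add_coset[OF r] cong: restrict_cong)
    show "h (vs_scale (cohomology ZT (total_d d) k) c C) =
        vs_scale (vs_direct_sum ?J (\<lambda>j. cohomology (\<lambda>i. Z i j) (\<lambda>i. d i j) k)) c (h C)"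
      if "C \<in> (\<lambda>\<phi>. \<phi> +o ?R) ` ?Z" for c C
      using that by (auto simp: cohomology_def quotient_scale_coset[OF R] h vs_direct_sum_def
          quotient_scale_coset[OF r] cong: restrict_cong)
  qed
  then show ?thesis
    by (rule vs_isomorphicI)
qed

end

section \<open>The BGG complex of a bigraded family\<close>

theorem theorem2:
  fixes n N :: nat
    and Z :: "int \<Rightarrow> int \<Rightarrow> 'a::real_inner set"
    and d S :: "int \<Rightarrow> int \<Rightarrow> 'a \<Rightarrow> 'a"
  assumes Z_outside: "\<And>i j. \<not> (0 \<le> i \<and> i \<le> int n \<and> 0 \<le> j \<and> j \<le> int N) \<Longrightarrow> Z i j = {0}"
    and complexes: "\<And>j. hilbert_complex (\<lambda>i. Z i j) (\<lambda>i. d i j)"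
    and S_bounded: "\<And>i j. bounded_operator (Z i j) (Z (i + 1) (j - 1)) (S i j)"
    and S_closed_range: "\<And>i j. closed (S i j ` Z i j)"
    and S_d: "\<And>i j x. x \<in> Z i j \<Longrightarrow> S (i + 1) j (d i j x) = - d (i + 1) (j - 1) (S i j x)"
    and S_S: "\<And>i j x. x \<in> Z i j \<Longrightarrow> S (i + 1) (j - 1) (S i j x) = 0"
  defines "ZT \<equiv> total_space Z"
    and "dV \<equiv> twisted_d (total_d d) (total_S S)"
    and "U \<equiv> bgg_space (total_space Z) (total_S S)"
    and "D \<equiv> bgg_D (total_space Z) (total_d d) (total_S S)"
    and "A \<equiv> bgg_A (total_space Z) (total_d d) (total_S S)"
    and "B \<equiv> bgg_B (total_space Z) (total_d d) (total_S S)"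
  shows "hilbert_complex U D \<and>
    (\<forall>k. vs_isomorphic (cohomology U D k) (cohomology ZT dV k)) \<and>
    complex_map U D ZT dV A \<and>
    complex_map ZT dV U D B \<and>
    (\<forall>k. vs_iso_map (cohomology U D k) (cohomology ZT dV k) (induced_map ZT dV A k) \<and>
         vs_iso_map (cohomology ZT dV k) (cohomology U D k) (induced_map U D B k) \<and>
         (\<forall>c\<in>vs_carrier (cohomology U D k).
            induced_map U D B k (induced_map ZT dV A k c) = c) \<and>
         (\<forall>c\<in>vs_carrier (cohomology ZT dV k).
            induced_map ZT dV A k (induced_map U D B k c) = c)) \<and>
    (\<forall>K :: int \<Rightarrow> int \<Rightarrow> 'a \<Rightarrow> 'a.
       (\<forall>i j. bounded_operator (Z i j) (Z i (j - 1)) (K i j)) \<and>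
       (\<forall>i j. \<forall>x\<in>Z i j. S i (j - 1) (K i j x) = K (i + 1) (j - 1) (S i j x)) \<and>
       (\<forall>i j. \<forall>x\<in>Z i j. S i j x = d i (j - 1) (K i j x) - K (i + 1) j (d i j x)) \<longrightarrow>
       (\<forall>k. vs_isomorphic (cohomology U D k)
              (vs_direct_sum {0..int N} (\<lambda>j. cohomology (\<lambda>i. Z i j) (\<lambda>i. d i j) k))))"
proof -
  interpret bigraded: bigraded_bgg_closed Z N d S
  proof
    show "subspace (Z i j)" "complete (Z i j)" for i j
      using hilbert_complex_subspace[OF complexes, of i j]
        hilbert_complex_complete[OF complexes, of i j] by simp_all
    show "Z i j = {0}" if "\<not> (0 \<le> j \<and> j \<le> int N)" for i j
      using Z_outside that by blast
  qed (fact complexes S_bounded S_d S_S S_closed_range)+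
  interpret bgg_twist "total_space Z" "total_d d" "total_S S" "N + 1"
    by (rule bigraded.bgg_twist_total)
  have sum: "vs_isomorphic (cohomology U D k)
      (vs_direct_sum {0..int N} (\<lambda>j. cohomology (\<lambda>i. Z i j) (\<lambda>i. d i j) k))"
    if "(\<forall>i j. bounded_operator (Z i j) (Z i (j - 1)) (K i j)) \<and>
       (\<forall>i j. \<forall>x\<in>Z i j. S i (j - 1) (K i j x) = K (i + 1) (j - 1) (S i j x)) \<and>
       (\<forall>i j. \<forall>x\<in>Z i j. S i j x = d i (j - 1) (K i j x) - K (i + 1) j (d i j x))" for K k
  proof -
    interpret untwisting "total_space Z" "total_d d" "total_S S" "total_S K" "N + 1"
      by (rule bigraded.untwisting_total) (use that in blast)+
    show ?thesis
      unfolding U_def D_def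
      using vs_isomorphic_trans[OF vs_isomorphicI[OF induced_A_iso] vs_isomorphic_trans[OF
            twisted_cohomology_isomorphic bigraded.cohomology_total[OF complexes]]] .
  qed
  show ?thesis
  proof (intro conjI allI ballI impI)
    show "hilbert_complex U D"
      unfolding U_def D_def by (rule hilbert_complex_bgg)
    show "complex_map U D ZT dV A"
      unfolding U_def D_def ZT_def dV_def A_def by (rule complex_map_A)
    show "complex_map ZT dV U D B"
      unfolding U_def D_def ZT_def dV_def B_def by (rule complex_map_B)
    fix k
    show "vs_isomorphic (cohomology U D k) (cohomology ZT dV k)"
      unfolding U_def D_def ZT_def dV_def by (rule vs_isomorphicI[OF induced_A_iso])
    show "vs_iso_map (cohomology U D k) (cohomology ZT dV k) (induced_map ZT dV A k)"
      unfolding U_def D_def ZT_def dV_def A_def by (rule induced_A_iso)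
    show "vs_iso_map (cohomology ZT dV k) (cohomology U D k) (induced_map U D B k)"
      unfolding U_def D_def ZT_def dV_def B_def by (rule induced_B_iso)
    show "induced_map U D B k (induced_map ZT dV A k c) = c"
      if "c \<in> vs_carrier (cohomology U D k)" for c
      using that unfolding U_def D_def ZT_def dV_def A_def B_def
      by (rule induced_B_A)
    show "induced_map ZT dV A k (induced_map U D B k c) = c"
      if "c \<in> vs_carrier (cohomology ZT dV k)" for c
      using that unfolding U_def D_def ZT_def dV_def A_def B_def
      by (rule induced_A_B)
  qed (rule sum)
qed

end
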